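(* Let $B$ be a Banach space and let $\mathbb{Z}^d$ act ergodically on a probability space $(X,\mu)$ by measure-preserving transformations $(T_k)_{k\in\mathbb{Z}^d}$. Let $s:X\times\mathbb{Z}^d\times\mathbb{Z}^d\to B^*$ be a Gelfand $B$-cocycle (with respect to a Borel cocycle $c:\mathbb{Z}^d\times X\to\mathrm{Isom}(B^* )$, $\mathbb{Z}^d$ acting on itself by translation), and suppose that $x\mapsto s_x(0,n)$ lies in $L^{d,1}_{w^*}(X,\mu,B^* )$ for every $n\in\mathbb{Z}^d$. Put \[ f(x)=\max_{k=1,\dots,d}\max\big(\|s_x(0,e_k)\|_{B^*},\|s_x(0,-e_k)\|_{B^*}\big),\qquad Ms(x)=\sup_{n\ne0}\frac{\|s_x(0,n)\|_{B^*}}{|n|}. \] Then there is a constant $C>0$ (independent of $\lambda$) such that \[ \mu(\{x\in X: Ms(x)\ge\lambda\})\le\Big(\frac{C}{\lambda}\|f\|_{d,1}\Big)^d\qquad\text{for all }\lambda\ge1. \]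
   Context: $e_1,\dots,e_d$ is the standard basis of $\mathbb{Z}^d$ and $|\cdot|$ a norm on $\mathbb{Z}^d$. A Borel cocycle $c:\mathbb{Z}^d\times X\to\mathrm{Isom}(B^* )$ satisfies $c(k+k',x)=c(k,x)c(k',T_kx)$ with $(k,x)\mapsto c(k,x).z$ measurable. A Gelfand $B$-cocycle with respect to $c$ is a map $s$ with $s_x(m,l)+s_x(l,n)=s_x(m,n)$, $c(k,x).s_{T_kx}(m,n)=s_x(m+k,n+k)$, and $x\mapsto s_x(m,n)$ weak*-measurable with $x\mapsto\|s_x(m,n)\|_{B^*}$ measurable. Lorentz norm: with $d_f(\alpha)=\mu(|f|>\alpha)$, $f^*(t)=\inf\{s>0:d_f(s)\le t\}$, $\|f\|_{p,1}=\int_0^\infty t^{1/p}f^*(t)\,\frac{dt}{t}$. A weak*-measurable $h:X\to B^*$ lies in $L^{p,q}_{w^*}(X,B^* )$ if there is a nonnegative $g\in L^{p,q}(X)$ with $\|h(x)\|_{B^*}\le g(x)$ a.e. *)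

theory Defs
  imports "HOL-Analysis.Analysis" "HOL-Probability.Probability"
begin

text \<open>The dual space B* of a real Banach space B is modelled as the Banach space
  of functionals (blinfun) into real.  The group Z^d is  int ^ 'd  with
  d = CARD('d); the standard basis vector e_k is  axis k 1.\<close>

definition mp_action :: "'a measure \<Rightarrow> (int ^ 'd \<Rightarrow> 'a \<Rightarrow> 'a) \<Rightarrow> bool" where
  "mp_action M T \<longleftrightarrow>
     (\<forall>k. T k \<in> M \<rightarrow>\<^sub>M M \<and> distr M M (T k) = M) \<and>
     (\<forall>x\<in>space M. T 0 x = x) \<and>
     (\<forall>k k'. \<forall>x\<in>space M. T (k + k') x = T k (T k' x))"

definition ergodic_action :: "'a measure \<Rightarrow> (int ^ 'd \<Rightarrow> 'a \<Rightarrow> 'a) \<Rightarrow> bool" where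
  "ergodic_action M T \<longleftrightarrow> mp_action M T \<and>
     (\<forall>A\<in>sets M. (\<forall>k. T k -` A \<inter> space M = A) \<longrightarrow>
        emeasure M A = 0 \<or> emeasure M A = 1)"

text \<open>Borel cocycle c : Z^d \<times> X \<rightarrow> Isom(B*) (surjective linear isometries of B*),
  with  c(k+k',x) = c(k,x) c(k',T_k x)  and  (k,x) \<mapsto> c(k,x).z  (weak*-)measurable.
  Since Z^d is countable and discrete, joint measurability amounts to measurability
  in x for each k.\<close>
definition borel_cocycle ::
  "'a measure \<Rightarrow> (int ^ 'd \<Rightarrow> 'a \<Rightarrow> 'a) \<Rightarrow>
   (int ^ 'd \<Rightarrow> 'a \<Rightarrow> ('b::real_normed_vector \<Rightarrow>\<^sub>L real) \<Rightarrow> ('b \<Rightarrow>\<^sub>L real)) \<Rightarrow> bool" where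
  "borel_cocycle M T c \<longleftrightarrow>
     (\<forall>k. \<forall>x\<in>space M. linear (c k x) \<and> (\<forall>z. norm (c k x z) = norm z) \<and> surj (c k x)) \<and>
     (\<forall>k k'. \<forall>x\<in>space M. c (k + k') x = c k x \<circ> c k' (T k x)) \<and>
     (\<forall>k z b. (\<lambda>x. blinfun_apply (c k x z) b) \<in> borel_measurable M)"

definition weak_star_measurable :: "'a measure \<Rightarrow> ('a \<Rightarrow> ('b::real_normed_vector \<Rightarrow>\<^sub>L real)) \<Rightarrow> bool" where
  "weak_star_measurable M h \<longleftrightarrow> (\<forall>b. (\<lambda>x. blinfun_apply (h x) b) \<in> borel_measurable M)"

definition gelfand_cocycle ::
  "'a measure \<Rightarrow> (int ^ 'd \<Rightarrow> 'a \<Rightarrow> 'a) \<Rightarrow>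
   (int ^ 'd \<Rightarrow> 'a \<Rightarrow> ('b::real_normed_vector \<Rightarrow>\<^sub>L real) \<Rightarrow> ('b \<Rightarrow>\<^sub>L real)) \<Rightarrow>
   ('a \<Rightarrow> int ^ 'd \<Rightarrow> int ^ 'd \<Rightarrow> ('b \<Rightarrow>\<^sub>L real)) \<Rightarrow> bool" where
  "gelfand_cocycle M T c s \<longleftrightarrow>
     (\<forall>x\<in>space M. \<forall>m l n. s x m l + s x l n = s x m n) \<and>
     (\<forall>x\<in>space M. \<forall>k m n. c k x (s (T k x) m n) = s x (m + k) (n + k)) \<and>
     (\<forall>m n. weak_star_measurable M (\<lambda>x. s x m n) \<and>
            (\<lambda>x. norm (s x m n)) \<in> borel_measurable M)"

definition distrib_fun :: "'a measure \<Rightarrow> ('a \<Rightarrow> real) \<Rightarrow> real \<Rightarrow> ennreal" where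
  "distrib_fun M f \<alpha> = emeasure M {x \<in> space M. \<bar>f x\<bar> > \<alpha>}"

text \<open>Decreasing rearrangement f*(t) = inf{s > 0 : d_f(s) \<le> t} (inf of the empty set = \<infinity>).\<close>
definition decr_rearr :: "'a measure \<Rightarrow> ('a \<Rightarrow> real) \<Rightarrow> real \<Rightarrow> ennreal" where
  "decr_rearr M f t = Inf (ennreal ` {s. s > 0 \<and> distrib_fun M f s \<le> ennreal t})"

definition lorentz_norm_p1 :: "'a measure \<Rightarrow> real \<Rightarrow> ('a \<Rightarrow> real) \<Rightarrow> ennreal" where
  "lorentz_norm_p1 M p f =
     (\<integral>\<^sup>+ t. indicator {0<..} t * ennreal (t powr (1 / p) / t) * decr_rearr M f t \<partial>lborel)"

definition lorentz_space_p1 :: "'a measure \<Rightarrow> real \<Rightarrow> ('a \<Rightarrow> real) set" where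
  "lorentz_space_p1 M p = {g. g \<in> borel_measurable M \<and> lorentz_norm_p1 M p g < \<infinity>}"

definition lorentz_wstar_p1 ::
  "'a measure \<Rightarrow> real \<Rightarrow> ('a \<Rightarrow> ('b::real_normed_vector \<Rightarrow>\<^sub>L real)) set" where
  "lorentz_wstar_p1 M p = {h. weak_star_measurable M h \<and>
      (\<exists>g\<in>lorentz_space_p1 M p. (\<forall>x\<in>space M. g x \<ge> 0) \<and> (AE x in M. norm (h x) \<le> g x))}"

definition is_norm_on :: "(real ^ 'd \<Rightarrow> real) \<Rightarrow> bool" where
  "is_norm_on N \<longleftrightarrow> (\<forall>x. N x = 0 \<longleftrightarrow> x = 0) \<and>
     (\<forall>x y. N (x + y) \<le> N x + N y) \<and> (\<forall>a x. N (a *\<^sub>R x) = \<bar>a\<bar> * N x)"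

definition int_vec_to_real :: "int ^ 'd \<Rightarrow> real ^ 'd" where
  "int_vec_to_real n = (\<chi> i. real_of_int (n $ i))"

end

(* For a.e. x the function u = s_x(0, _) on Z^d has discrete gradient at most m |-> f(T_m x).
   Averaging over discretised segments from 0, and from n, to a common cube of side R = |n|_oo
   gives
     |u(n) - u(0)| <= C sum_{i <= R} i^-d sum_q (f(T_q x) + f(T_{n+q} x)),  q in [i-1, 4i]^d.
   With tau(t) = mu(f > t)^(1/d), cut this sum, for the level set {f > t}, at i = theta R tau(t):
   the small i contribute at most C theta R tau(t), whose integral over t is at most
   C theta R ||f||_{d,1}; the large i contribute at most C (theta R)^(1-d) times the sum over a
   cube of side about R of h(T_m x), where h = int_0^f tau(t)^(1-d) dt has
   int h dmu = int tau(t) dt <= ||f||_{d,1}.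
   Off the set where the cube averages of h exceed theta^d ||f||_{d,1} one therefore gets
   |u(n)| <= C theta ||f||_{d,1} |n|, and the Wiener maximal inequality bounds the measure of that
   set by C theta^-d.  Take theta proportional to lambda / ||f||_{d,1}. *)

theory Submission
  imports Defs
begin

section \<open>Integer cubes and coordinatewise counting\<close>

definition int_cube :: "int \<Rightarrow> int \<Rightarrow> (int ^ 'd) set" where
  "int_cube a b = {v. \<forall>i. a \<le> v $ i \<and> v $ i \<le> b}"

lemma card_vec_set:
  fixes S :: "'d::finite \<Rightarrow> 'c set"
  assumes "\<And>i. finite (S i)"
  shows "finite {v :: 'c ^ 'd. \<forall>i. v $ i \<in> S i}"
    and "card {v :: 'c ^ 'd. \<forall>i. v $ i \<in> S i} = (\<Prod>i\<in>UNIV. card (S i))"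
proof -
  have eq: "{v :: 'c ^ 'd. \<forall>i. v $ i \<in> S i} = vec_lambda ` Pi\<^sub>E UNIV S"
  proof (intro equalityI subsetI)
    fix v :: "'c ^ 'd" assume "v \<in> {v. \<forall>i. v $ i \<in> S i}"
    then have "vec_nth v \<in> Pi\<^sub>E UNIV S" by auto
    then show "v \<in> vec_lambda ` Pi\<^sub>E UNIV S" by (metis image_eqI vec_nth_inverse)
  qed auto
  have inj: "inj_on vec_lambda (Pi\<^sub>E UNIV S)"
    by (intro inj_onI) (metis UNIV_I vec_lambda_inject)
  show "finite {v :: 'c ^ 'd. \<forall>i. v $ i \<in> S i}"
    unfolding eq using assms by (intro finite_imageI finite_PiE) auto
  show "card {v :: 'c ^ 'd. \<forall>i. v $ i \<in> S i} = (\<Prod>i\<in>UNIV. card (S i))"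
    unfolding eq card_image[OF inj] by (simp add: card_PiE)
qed

lemma finite_int_cube [simp]: "finite (int_cube a b :: (int ^ 'd) set)"
  using card_vec_set(1)[of "\<lambda>_::'d. {a..b}"] by (simp add: int_cube_def)

lemma card_int_cube: "card (int_cube a b :: (int ^ 'd) set) = nat (b - a + 1) ^ CARD('d)"
  using card_vec_set(2)[of "\<lambda>_::'d. {a..b}"] by (simp add: int_cube_def)

lemma mem_int_cube: "v \<in> int_cube a b \<longleftrightarrow> (\<forall>i. a \<le> v $ i \<and> v $ i \<le> b)"
  by (simp add: int_cube_def)

lemma int_cube_mono: "a' \<le> a \<Longrightarrow> b \<le> b' \<Longrightarrow> int_cube a b \<subseteq> int_cube a' b'"
  by (smt (verit) mem_int_cube subsetI)

lemma sum_translate_le: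
  fixes g :: "int ^ 'd \<Rightarrow> 'c::ordered_comm_monoid_add"
  assumes "\<And>x. 0 \<le> g x" and "finite B" and "\<And>x. x \<in> A \<Longrightarrow> a + x \<in> B"
  shows "(\<Sum>x\<in>A. g (a + x)) \<le> sum g B"
proof -
  have "(\<Sum>x\<in>A. g (a + x)) = sum g ((+) a ` A)"
    by (subst sum.reindex) (auto simp: inj_on_def)
  also have "\<dots> \<le> sum g B"
    by (rule sum_mono2) (use assms in auto)
  finally show ?thesis .
qed

section \<open>The Wiener maximal inequality\<close>

text \<open>Greedy selection: keep a cube of maximal radius, discard every cube that meets it, and
  recurse. A discarded cube has radius at most that of the kept one, so its centre lies within twice
  the kept radius. Since only centres have to be covered, the dilation factor is 2 and not the usual
  3.\<close>

lemma vitali_cubes: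
  fixes r :: "int ^ 'd \<Rightarrow> nat"
  assumes "finite I"
  shows "\<exists>J\<subseteq>I. disjoint_family_on (\<lambda>j. (+) j ` int_cube (- int (r j)) (int (r j))) J \<and>
           (\<forall>i\<in>I. \<exists>j\<in>J. i - j \<in> int_cube (- (2 * int (r j))) (2 * int (r j)))"
  using assms
proof (induction "card I" arbitrary: I rule: less_induct)
  case less
  define B where "B j = (+) j ` int_cube (- int (r j)) (int (r j))" for j :: "int ^ 'd"
  show ?case
  proof (cases "I = {}")
    case True
    then show ?thesis by (auto simp: disjoint_family_on_def)
  next
    case False
    obtain i0 where i0: "i0 \<in> I" and mx: "\<And>i. i \<in> I \<Longrightarrow> r i \<le> r i0"
    proof -
      obtain i0 where "i0 \<in> I" "r i0 = Max (r ` I)"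
        using Max_in[of "r ` I"] less.prems False by (metis (no_types, lifting) finite_imageI imageE image_is_empty)
      then show ?thesis using that less.prems by simp
    qed
    define I' where "I' = {i \<in> I. B i \<inter> B i0 = {}}"
    have "i0 \<in> B i0" by (auto simp: B_def mem_int_cube image_iff intro!: bexI[of _ 0])
    then have "i0 \<notin> I'" by (auto simp: I'_def)
    then have "card I' < card I"
      using i0 less.prems by (intro psubset_card_mono) (auto simp: I'_def)
    moreover have "finite I'" using less.prems by (auto simp: I'_def)
    ultimately obtain J where J: "J \<subseteq> I'" "disjoint_family_on B J"
      "\<forall>i\<in>I'. \<exists>j\<in>J. i - j \<in> int_cube (- (2 * int (r j))) (2 * int (r j))"
      using less.hyps[of I'] unfolding B_def by blast
    have "disjoint_family_on B (insert i0 J)"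
      using J(1,2) \<open>i0 \<notin> I'\<close> by (subst disjoint_family_on_insert) (auto simp: I'_def)
    moreover have "\<exists>j\<in>insert i0 J. i - j \<in> int_cube (- (2 * int (r j))) (2 * int (r j))" if i: "i \<in> I" for i
    proof (cases "i \<in> I'")
      case True
      then show ?thesis using J(3) by auto
    next
      case False
      then obtain z where "z \<in> B i" "z \<in> B i0" using i by (auto simp: I'_def)
      then obtain v w where vw: "v \<in> int_cube (- int (r i)) (int (r i))" "w \<in> int_cube (- int (r i0)) (int (r i0))"
        "i + v = i0 + w" unfolding B_def by force
      have "i - i0 = w - v" using vw(3) by (simp add: algebra_simps)
      moreover have "w - v \<in> int_cube (- (2 * int (r i0))) (2 * int (r i0))"
        unfolding mem_int_cube
      proof
        fix k
        have "- int (r i) \<le> v $ k \<and> v $ k \<le> int (r i)" "- int (r i0) \<le> w $ k \<and> w $ k \<le> int (r i0)"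
          using vw(1,2) by (auto simp: mem_int_cube)
        then show "- (2 * int (r i0)) \<le> (w - v) $ k \<and> (w - v) $ k \<le> 2 * int (r i0)"
          using mx[OF i] by simp
      qed
      ultimately show ?thesis by (intro bexI[of _ i0]) auto
    qed
    moreover have "insert i0 J \<subseteq> I" using J(1) i0 by (auto simp: I'_def)
    ultimately show ?thesis unfolding B_def by (intro exI[of _ "insert i0 J"]) auto
  qed
qed

text \<open>Weak type (1,1) for cube averages in a finite window. The doubled Vitali cubes cover
  \<open>E\<close>, while the lower bounds on the disjoint cubes themselves add up. A cube with
  centre in [-R,R]^d and radius at most R stays in [-2R,2R]^d.\<close>

lemma lattice_maximal_inequality:
  fixes g :: "int ^ 'd \<Rightarrow> ennreal" and r :: "int ^ 'd \<Rightarrow> nat"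
  assumes E: "E \<subseteq> int_cube (- int R) (int R)"
    and r: "\<And>n. n \<in> E \<Longrightarrow> 1 \<le> r n \<and> r n \<le> R"
    and big: "\<And>n. n \<in> E \<Longrightarrow> \<alpha> * of_nat (r n ^ CARD('d)) \<le> (\<Sum>m\<in>int_cube (- int (r n)) (int (r n)). g (n + m))"
  shows "\<alpha> * of_nat (card E) \<le> 5 ^ CARD('d) * sum g (int_cube (- (2 * int R)) (2 * int R))"
proof -
  let ?d = "CARD('d)"
  define B where "B j = (+) j ` int_cube (- int (r j)) (int (r j))" for j :: "int ^ 'd"
  have fE: "finite E" using E finite_subset by fastforce
  obtain J where J: "J \<subseteq> E" "disjoint_family_on B J"
      "\<forall>i\<in>E. \<exists>j\<in>J. i - j \<in> int_cube (- (2 * int (r j))) (2 * int (r j))"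
    using vitali_cubes[OF fE, of r] unfolding B_def by blast
  have fJ: "finite J" using J(1) fE finite_subset by blast
  have "E \<subseteq> (\<Union>j\<in>J. (+) j ` int_cube (- (2 * int (r j))) (2 * int (r j)))"
  proof
    fix i assume "i \<in> E"
    then obtain j where "j \<in> J" "i - j \<in> int_cube (- (2 * int (r j))) (2 * int (r j))" using J(3) by blast
    then show "i \<in> (\<Union>j\<in>J. (+) j ` int_cube (- (2 * int (r j))) (2 * int (r j)))"
      by (intro UN_I[of j]) (auto intro!: image_eqI[of _ _ "i - j"])
  qed
  then have "card E \<le> card (\<Union>j\<in>J. (+) j ` int_cube (- (2 * int (r j))) (2 * int (r j)))"
    using fJ by (intro card_mono) auto
  also have "\<dots> \<le> (\<Sum>j\<in>J. card ((+) j ` (int_cube (- (2 * int (r j))) (2 * int (r j)) :: (int ^ 'd) set)))"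
    by (rule card_UN_le[OF fJ])
  also have "\<dots> \<le> (\<Sum>j\<in>J. 5 ^ ?d * r j ^ ?d)"
  proof (rule sum_mono)
    fix j assume j: "j \<in> J"
    have "card ((+) j ` (int_cube (- (2 * int (r j))) (2 * int (r j)) :: (int ^ 'd) set)) 
        \<le> card (int_cube (- (2 * int (r j))) (2 * int (r j)) :: (int ^ 'd) set)"
      by (rule card_image_le) simp
    \<comment> \<open>The side of the doubled cube has 4r + 1 points, and 4r + 1 \<le> 5r because r
      \<ge> 1.\<close>
    also have "\<dots> \<le> (5 * r j) ^ ?d"
      unfolding card_int_cube using r[OF subsetD[OF J(1) j]] by (intro power_mono) auto
    finally show "card ((+) j ` (int_cube (- (2 * int (r j))) (2 * int (r j)) :: (int ^ 'd) set)) \<le> 5 ^ ?d * r j ^ ?d"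
      by (simp add: power_mult_distrib)
  qed
  finally have "\<alpha> * of_nat (card E) \<le> \<alpha> * of_nat (\<Sum>j\<in>J. 5 ^ ?d * r j ^ ?d)"
    by (intro mult_left_mono of_nat_mono) auto
  also have "\<dots> = 5 ^ ?d * (\<Sum>j\<in>J. \<alpha> * of_nat (r j ^ ?d))"
    by (simp add: sum_distrib_left mult_ac)
  also have "(\<Sum>j\<in>J. \<alpha> * of_nat (r j ^ ?d)) \<le> (\<Sum>j\<in>J. sum g (B j))"
  proof (rule sum_mono)
    fix j assume "j \<in> J"
    then have "\<alpha> * of_nat (r j ^ ?d) \<le> (\<Sum>m\<in>int_cube (- int (r j)) (int (r j)). g (j + m))"
      using big J(1) by blast
    also have "\<dots> = sum g (B j)" unfolding B_def by (subst sum.reindex) (auto simp: inj_on_def)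
    finally show "\<alpha> * of_nat (r j ^ ?d) \<le> sum g (B j)" .
  qed
  also have "(\<Sum>j\<in>J. sum g (B j)) = sum g (\<Union>j\<in>J. B j)"
    using fJ J(2) by (subst sum.UNION_disjoint) (auto simp: B_def disjoint_family_on_def)
  also have "\<dots> \<le> sum g (int_cube (- (2 * int R)) (2 * int R))"
  proof (rule sum_mono2)
    show "(\<Union>j\<in>J. B j) \<subseteq> int_cube (- (2 * int R)) (2 * int R)"
    proof (safe)
      fix j z assume j: "j \<in> J" "z \<in> B j"
      then obtain v where v: "z = j + v" "v \<in> int_cube (- int (r j)) (int (r j))" by (auto simp: B_def)
      show "z \<in> int_cube (- (2 * int R)) (2 * int R)"
        unfolding mem_int_cube
      proof
        fix k
        have "- int (r j) \<le> v $ k \<and> v $ k \<le> int (r j)" "- int R \<le> j $ k \<and> j $ k \<le> int R"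
          using v j J(1) E by (auto simp: mem_int_cube)
        then show "- (2 * int R) \<le> z $ k \<and> z $ k \<le> 2 * int R"
          using r[of j] j(1) J(1) v(1) by auto
      qed
    qed
  qed auto
  finally show ?thesis by (simp add: mult_left_mono)
qed

text \<open>Calderon transference: radii are first truncated at R, so that only a finite piece of
  each orbit matters, and then R tends to infinity. The base 10 is the 5 of the lattice inequality
  times 2, the latter bounding the ratio of the side lengths 4R + 1 and 2R + 1 of the two
  windows.\<close>

lemma wiener_maximal_inequality:
  fixes T :: "int ^ 'd \<Rightarrow> 'a \<Rightarrow> 'a" and h :: "'a \<Rightarrow> ennreal"
  assumes T: "mp_action M T" and h: "h \<in> borel_measurable M"
  shows "\<alpha> * emeasure M {x \<in> space M. \<exists>r\<ge>1. \<alpha> * of_nat (r ^ CARD('d)) <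
            (\<Sum>m\<in>int_cube (- int r) (int r). h (T m x))} \<le> 10 ^ CARD('d) * (\<integral>\<^sup>+x. h x \<partial>M)"
proof -
  let ?d = "CARD('d)"
  have Tm [measurable]: "T k \<in> M \<rightarrow>\<^sub>M M" for k using T by (simp add: mp_action_def)
  note h [measurable]
  have Tspace: "T k x \<in> space M" if "x \<in> space M" for k x
    using measurable_space[OF Tm that] .
  have inv: "(\<integral>\<^sup>+x. G (T k x) \<partial>M) = (\<integral>\<^sup>+x. G x \<partial>M)" if "G \<in> borel_measurable M" for G :: "'a \<Rightarrow> ennreal" and k
  proof -
    have "(\<integral>\<^sup>+x. G x \<partial>M) = (\<integral>\<^sup>+x. G x \<partial>distr M M (T k))" using T by (simp add: mp_action_def)
    also have "\<dots> = (\<integral>\<^sup>+x. G (T k x) \<partial>M)" using that by (intro nn_integral_distr) auto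
    finally show ?thesis by simp
  qed
  define E where "E R = {x \<in> space M. \<exists>r\<in>{1..R}. \<alpha> * of_nat (r ^ ?d) <
            (\<Sum>m\<in>int_cube (- int r) (int r). h (T m x))}" for R
  have E_meas [measurable]: "E R \<in> sets M" for R unfolding E_def by measurable
  have bound: "\<alpha> * emeasure M (E R) \<le> 10 ^ ?d * (\<integral>\<^sup>+x. h x \<partial>M)" for R
  proof -
    let ?B = "int_cube (- int R) (int R) :: (int ^ 'd) set"
    let ?B2 = "int_cube (- (2 * int R)) (2 * int R) :: (int ^ 'd) set"
    \<comment> \<open>Transference: apply the lattice inequality along the orbit of x and integrate.\<close>
    have pt: "\<alpha> * (\<Sum>n\<in>?B. indicator (E R) (T n x)) \<le> 5 ^ ?d * (\<Sum>m\<in>?B2. h (T m x))"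
      if x: "x \<in> space M" for x
    proof -
      define F where "F = {n \<in> ?B. T n x \<in> E R}"
      have "\<forall>n\<in>F. \<exists>r. r \<in> {1..R} \<and> \<alpha> * of_nat (r ^ ?d) < (\<Sum>m\<in>int_cube (- int r) (int r). h (T m (T n x)))"
        unfolding F_def E_def by auto
      then obtain r where r: "\<And>n. n \<in> F \<Longrightarrow> r n \<in> {1..R} \<and> \<alpha> * of_nat (r n ^ ?d) < (\<Sum>m\<in>int_cube (- int (r n)) (int (r n)). h (T m (T n x)))"
        by metis
      have TT: "T m (T n x) = T (n + m) x" for m n
        using T x unfolding mp_action_def by (metis add.commute)
      have "\<alpha> * of_nat (card F) \<le> 5 ^ ?d * (\<Sum>m\<in>?B2. h (T m x))"
        by (rule lattice_maximal_inequality[where r = r])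
           (use r in \<open>auto simp: F_def TT intro: less_imp_le\<close>)
      moreover have "(\<Sum>n\<in>?B. indicator (E R) (T n x)) = (of_nat (card F) :: ennreal)"
      proof -
        have "(\<Sum>n\<in>?B. indicator (E R) (T n x) :: ennreal) = (\<Sum>n\<in>?B. indicator F n)"
          by (intro sum.cong) (auto simp: F_def indicator_def)
        also have "\<dots> = of_nat (card (?B \<inter> F))" by (simp add: sum.If_cases indicator_def)
        also have "?B \<inter> F = F" by (auto simp: F_def)
        finally show ?thesis .
      qed
      ultimately show ?thesis by simp
    qed
    \<comment> \<open>Each T_n preserves the measure, so every summand over the window integrates to
      the measure of \<open>E R\<close>.\<close>
    have "of_nat (card ?B) * (\<alpha> * emeasure M (E R)) = \<alpha> * (\<Sum>n\<in>?B. \<integral>\<^sup>+x. indicator (E R) (T n x) \<partial>M)"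
      by (subst inv) (simp_all add: mult_ac)
    also have "\<dots> = (\<integral>\<^sup>+x. \<alpha> * (\<Sum>n\<in>?B. indicator (E R) (T n x)) \<partial>M)"
      by (subst nn_integral_cmult, measurable) (subst nn_integral_sum, measurable)
    also have "\<dots> \<le> (\<integral>\<^sup>+x. 5 ^ ?d * (\<Sum>m\<in>?B2. h (T m x)) \<partial>M)"
      by (intro nn_integral_mono pt)
    also have "\<dots> = 5 ^ ?d * (\<Sum>m\<in>?B2. \<integral>\<^sup>+x. h (T m x) \<partial>M)"
      by (subst nn_integral_cmult, measurable) (subst nn_integral_sum, measurable)
    also have "\<dots> = 5 ^ ?d * (of_nat (card ?B2) * (\<integral>\<^sup>+x. h x \<partial>M))"
      by (simp add: inv)
    also have "\<dots> \<le> 5 ^ ?d * (of_nat (2 ^ ?d * card ?B) * (\<integral>\<^sup>+x. h x \<partial>M))"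
    proof -
      have "card ?B2 \<le> (2 * nat (2 * int R + 1)) ^ ?d" unfolding card_int_cube by (intro power_mono) auto
      also have "\<dots> = 2 ^ ?d * card ?B" by (simp add: card_int_cube power_mult_distrib)
      finally have "(of_nat (card ?B2) :: ennreal) \<le> of_nat (2 ^ ?d * card ?B)" using of_nat_mono by blast
      then show ?thesis by (intro mult_left_mono mult_right_mono) auto
    qed
    also have "\<dots> = of_nat (card ?B) * (10 ^ ?d * (\<integral>\<^sup>+x. h x \<partial>M))"
    proof -
      have "(10::ennreal) ^ ?d = 5 ^ ?d * 2 ^ ?d" by (simp flip: power_mult_distrib)
      then show ?thesis by (simp add: mult_ac)
    qed
    finally have "of_nat (card ?B) * (\<alpha> * emeasure M (E R)) \<le> of_nat (card ?B) * (10 ^ ?d * (\<integral>\<^sup>+x. h x \<partial>M))" .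
    moreover have "card ?B > 0" by (simp add: card_int_cube)
    ultimately show ?thesis
      by (subst (asm) ennreal_mult_le_mult_iff) (auto simp: of_nat_less_top)
  qed
  have "{x \<in> space M. \<exists>r\<ge>1. \<alpha> * of_nat (r ^ CARD('d)) <
            (\<Sum>m\<in>int_cube (- int r) (int r). h (T m x))} = (\<Union>R. E R)"
    unfolding E_def by fastforce
  moreover have "\<alpha> * emeasure M (\<Union>R. E R) \<le> 10 ^ ?d * (\<integral>\<^sup>+x. h x \<partial>M)"
  proof -
    \<comment> \<open>Removing the truncation: the sets \<open>E R\<close> increase with R, so the
      uniform bound passes to their union by continuity from below.\<close>
    have "incseq E" unfolding E_def incseq_def by fastforce
    then have "emeasure M (\<Union>R. E R) = (SUP R. emeasure M (E R))"
      by (intro SUP_emeasure_incseq[symmetric]) auto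
    then show ?thesis by (simp add: SUP_mult_left_ennreal SUP_least bound)
  qed
  ultimately show ?thesis by simp
qed

section \<open>A potential estimate on the lattice\<close>

text \<open>Descend from q + e to q by unit steps, lowering one positive coordinate at a time. Each
  step is charged to its upper endpoint; these endpoints are distinct and lie in the box between q
  and q + e.\<close>

lemma monotone_path_bound:
  fixes u :: "int ^ 'd \<Rightarrow> 'v::real_normed_vector"
  assumes grad: "\<And>m k. norm (u (m - axis k 1) - u m) \<le> \<phi> m"
    and e: "e \<in> int_cube 0 L"
  shows "norm (u (q + e) - u q) \<le> (\<Sum>e'\<in>int_cube 0 L. \<phi> (q + e'))"
proof -
  have pos: "0 \<le> \<phi> m" for m using grad order_trans[OF norm_ge_zero] by blast
  let ?P = "\<lambda>e. {e'. \<forall>i. 0 \<le> e' $ i \<and> e' $ i \<le> e $ i} :: (int ^ 'd) set"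
  have fin: "finite (?P e)" for e
    using card_vec_set(1)[of "\<lambda>i::'d. {0..e $ i}"] by simp
  have "norm (u (q + e) - u q) \<le> (\<Sum>e'\<in>?P e. \<phi> (q + e'))"
    if "\<forall>i. 0 \<le> e $ i" for e :: "int ^ 'd"
    using that
  proof (induction "nat (\<Sum>i\<in>UNIV. e $ i)" arbitrary: e rule: less_induct)
    case less
    show ?case
    proof (cases "e = 0")
      case True
      then show ?thesis by (simp add: sum_nonneg pos)
    next
      case False
      then obtain k where "e $ k \<noteq> 0" by (auto simp: vec_eq_iff)
      then have k: "e $ k \<ge> 1" using less.prems by (metis antisym_conv2 int_one_le_iff_zero_less)
      define e1 where "e1 = e - axis k 1"
      have e1: "e1 $ i = e $ i - (if i = k then 1 else 0)" for i
        by (simp add: e1_def axis_def)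
      have nn: "\<forall>i. 0 \<le> e1 $ i" using less.prems k by (simp add: e1)
      have "(\<Sum>i\<in>UNIV. e1 $ i) = (\<Sum>i\<in>UNIV. e $ i) - 1"
        by (simp add: e1 sum_subtractf)
      moreover have "(\<Sum>i\<in>UNIV. e $ i) \<ge> e $ k"
        using less.prems by (intro member_le_sum) auto
      ultimately have "norm (u (q + e1) - u q) \<le> (\<Sum>e'\<in>?P e1. \<phi> (q + e'))"
        using k nn by (intro less.hyps) auto
      moreover have "norm (u (q + e) - u (q + e1)) \<le> \<phi> (q + e)"
        using grad[of "q + e" k] by (simp add: e1_def norm_minus_commute add_diff_eq)
      ultimately have "norm (u (q + e) - u q) \<le> \<phi> (q + e) + (\<Sum>e'\<in>?P e1. \<phi> (q + e'))"
        using norm_triangle_ineq[of "u (q + e) - u (q + e1)" "u (q + e1) - u q"] by simp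
      also have "\<dots> = (\<Sum>e'\<in>insert e (?P e1). \<phi> (q + e'))"
      proof -
        \<comment> \<open>The new endpoint is not counted twice: its coordinate k exceeds that of
          \<open>e1\<close> by one.\<close>
        have "e \<notin> ?P e1" using e1[of k] by (auto intro!: exI[of _ k])
        then show ?thesis using fin[of e1] by simp
      qed
      also have "\<dots> \<le> (\<Sum>e'\<in>?P e. \<phi> (q + e'))"
      proof (rule sum_mono2[OF fin])
        show "insert e (?P e1) \<subseteq> ?P e"
          using less.prems by (auto simp: e1)
      qed (simp add: pos)
      finally show ?thesis .
    qed
  qed
  also have "(\<Sum>e'\<in>?P e. \<phi> (q + e')) \<le> (\<Sum>e'\<in>int_cube 0 L. \<phi> (q + e'))"
  proof (rule sum_mono2)
    show "?P e \<subseteq> int_cube 0 L"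
      using e by (smt (verit) mem_Collect_eq mem_int_cube subsetI)
  qed (auto simp: pos)
  finally show ?thesis using e by (simp add: mem_int_cube)
qed

section \<open>Averaging over discretised segments\<close>

text \<open>The point j/R of the way from 0 to w, rounded down in each coordinate; for R > 0 it is
  exactly 0 at j = 0 and exactly w at j = R.\<close>

definition segment_point :: "nat \<Rightarrow> nat \<Rightarrow> int ^ 'd \<Rightarrow> int ^ 'd" where
  "segment_point R j w = (\<chi> i. (int j * w $ i) div int R)"

text \<open>Telescoping along the rounded segment. Each coordinate of w/R lies in [0,4], so
  consecutive rounded points differ by a vector of [0,4]^d and the monotone path bound applies with
  \<open>L = 4\<close>.\<close>

lemma segment_path_bound:
  fixes u :: "int ^ 'd \<Rightarrow> 'v::real_normed_vector"
  assumes grad: "\<And>m k. norm (u (m - axis k 1) - u m) \<le> \<phi> m"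
    and R: "R \<ge> 1" and w: "w \<in> int_cube 0 (4 * int R)"
  shows "norm (u (a + w) - u a) \<le> (\<Sum>j<R. \<Sum>e\<in>int_cube 0 4. \<phi> (a + segment_point R j w + e))"
proof -
  let ?p = "\<lambda>j. segment_point R j w"
  have p0: "?p 0 = 0" by (simp add: segment_point_def vec_eq_iff)
  have pR: "?p R = w" using R by (simp add: segment_point_def vec_eq_iff)
  have step: "?p (Suc j) - ?p j \<in> int_cube 0 4" for j
    unfolding mem_int_cube
  proof
    fix i
    have w: "0 \<le> w $ i" "w $ i \<le> 4 * int R" using w by (auto simp: mem_int_cube)
    have eq: "int (Suc j) * w $ i = int j * w $ i + w $ i" by (simp add: algebra_simps)
    have "(int j * w $ i + w $ i) div int R \<ge> (int j * w $ i) div int R"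
      using w R by (intro zdiv_mono1) auto
    moreover have "(int j * w $ i + w $ i) div int R \<le> (int j * w $ i + 4 * int R) div int R"
      using w R by (intro zdiv_mono1) auto
    moreover have "(int j * w $ i + 4 * int R) div int R = (int j * w $ i) div int R + 4"
      using R by simp
    ultimately show "0 \<le> (?p (Suc j) - ?p j) $ i \<and> (?p (Suc j) - ?p j) $ i \<le> 4"
      unfolding segment_point_def vector_minus_component vec_lambda_beta eq by linarith
  qed
  have "u (a + w) - u a = (\<Sum>j<R. u (a + ?p (Suc j)) - u (a + ?p j))"
    by (subst sum_lessThan_telescope[of "\<lambda>j. u (a + ?p j)"]) (simp add: p0 pR)
  also have "norm \<dots> \<le> (\<Sum>j<R. \<Sum>e\<in>int_cube 0 4. \<phi> (a + ?p j + e))"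
  proof (rule sum_norm_le)
    fix j
    show "norm (u (a + ?p (Suc j)) - u (a + ?p j)) \<le> (\<Sum>e\<in>int_cube 0 4. \<phi> (a + ?p j + e))"
      using monotone_path_bound[of u \<phi>, OF grad step, of "a + ?p j" j] by simp
  qed
  finally show ?thesis .
qed

text \<open>For j > 0 the fibre lies in an interval with (R-1) div j + 1 points. The factor j + 1 in
  place of j lets the same bound cover j = 0, where all 3R + 1 \<le> 4R values are allowed.\<close>

lemma card_div_fibre:
  assumes "j < R"
  shows "card {w \<in> {int R..4 * int R}. (int j * w) div int R = p} * (j + 1) \<le> 4 * R"
proof (cases "j = 0")
  case True
  have "card {w \<in> {int R..4 * int R}. (int j * w) div int R = p} \<le> card {int R..4 * int R}"
    by (intro card_mono) auto
  then show ?thesis using True assms by simp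
next
  case False
  let ?F = "{w \<in> {int R..4 * int R}. (int j * w) div int R = p}"
  show ?thesis
  proof (cases "?F = {}")
    case True
    show ?thesis unfolding True by simp
  next
    case ne: False
    have fin: "finite ?F" by (rule finite_subset[of _ "{int R..4 * int R}"]) auto
    define a where "a = Min ?F"
    have a: "a \<in> ?F" unfolding a_def using fin ne by (rule Min_in)
    have "?F \<subseteq> {a..a + int ((R - 1) div j)}"
    proof
      fix w assume w: "w \<in> ?F"
      have "a \<le> w" unfolding a_def using w fin by simp
      have "int j * w = int R * p + (int j * w) mod int R" "int j * a = int R * p + (int j * a) mod int R"
        using w a mult_div_mod_eq[of "int R" "int j * w"] mult_div_mod_eq[of "int R" "int j * a"] by simp_all
      moreover have "(int j * w) mod int R < int R" "(int j * a) mod int R \<ge> 0" using assms by auto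
      \<comment> \<open>Two multiples of j with the same quotient modulo R differ only in their
        remainders, hence by at most R - 1.\<close>
      ultimately have "int j * w - int j * a \<le> int (R - 1)" using assms by linarith
      then have "(w - a) * int j \<le> int (R - 1)" by (simp add: algebra_simps)
      then have "w - a \<le> int (R - 1) div int j" using False
        by (metis zdiv_mono1 nonzero_mult_div_cancel_right of_nat_0_less_iff of_nat_eq_0_iff not_gr0)
      then show "w \<in> {a..a + int ((R - 1) div j)}" using \<open>a \<le> w\<close> by (simp add: zdiv_int)
    qed
    then have "card ?F \<le> card {a..a + int ((R - 1) div j)}" by (intro card_mono) auto
    then have c: "card ?F \<le> (R - 1) div j + 1" by simp
    have "j * card ?F \<le> j * ((R - 1) div j) + j" using mult_left_mono[OF c, of j] by simp
    also have "\<dots> \<le> (R - 1) + j" by simp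
    finally have "j * card ?F \<le> 2 * R" using assms by simp
    moreover have "card ?F \<le> j * card ?F" using False by simp
    \<comment> \<open>Here c(j + 1) = cj + c \<le> 2cj, which explains the passage from 2R to
      4R.\<close>
    moreover have "c * (j + 1) \<le> 4 * R" if "j * c \<le> 2 * R" "c \<le> j * c" for c
      using that unfolding distrib_left mult.commute[of c j] by linarith
    ultimately show ?thesis by blast
  qed
qed

text \<open>The endpoints w that pass through a given p at time j form a product of one-dimensional
  fibres, so there are at most (4R/(j+1))^d of them. Keeping w away from the origin, in [R,4R]^d,
  confines p to [j,4j]^d; this lower bound j is what later avoids a logarithm.\<close>

lemma sum_segment_point_le:
  fixes g :: "int ^ 'd \<Rightarrow> real"
  assumes j: "j < R" and g: "\<And>p. 0 \<le> g p"
  shows "(\<Sum>w\<in>int_cube (int R) (4 * int R). g (segment_point R j w)) \<le>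
    (4 * real R / real (j + 1)) ^ CARD('d) * sum g (int_cube (int j) (4 * int j))"
proof -
  let ?W = "int_cube (int R) (4 * int R) :: (int ^ 'd) set" and ?P = "int_cube (int j) (4 * int j) :: (int ^ 'd) set"
  have im: "segment_point R j ` ?W \<subseteq> ?P"
  proof (clarsimp simp: mem_int_cube segment_point_def)
    fix w :: "int ^ 'd" and i assume "\<forall>i. int R \<le> w $ i \<and> w $ i \<le> 4 * int R"
    then have w: "int R \<le> w $ i" "w $ i \<le> 4 * int R" by auto
    have "int j * int R div int R \<le> int j * w $ i div int R" "int j * w $ i div int R \<le> int j * (4 * int R) div int R"
      using w j by (intro zdiv_mono1 mult_left_mono; simp)+
    then show "int j \<le> int j * w $ i div int R \<and> int j * w $ i div int R \<le> 4 * int j"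
      using j by (simp add: mult.assoc[symmetric])
  qed
  have "(\<Sum>w\<in>?W. g (segment_point R j w)) = (\<Sum>p\<in>?P. \<Sum>w\<in>{w\<in>?W. segment_point R j w = p}. g (segment_point R j w))"
    by (rule sum.group[symmetric, OF finite_int_cube finite_int_cube im])
  also have "\<dots> = (\<Sum>p\<in>?P. real (card {w\<in>?W. segment_point R j w = p}) * g p)"
    by (intro sum.cong) auto
  also have "\<dots> \<le> (\<Sum>p\<in>?P. (4 * real R / real (j + 1)) ^ CARD('d) * g p)"
  proof (intro sum_mono mult_right_mono g)
    fix p :: "int ^ 'd"
    let ?S = "\<lambda>i. {w \<in> {int R..4 * int R}. (int j * w) div int R = p $ i}"
    have "{w\<in>?W. segment_point R j w = p} = {w. \<forall>i. w $ i \<in> ?S i}"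
      by (simp add: mem_int_cube segment_point_def vec_eq_iff all_conj_distrib)
    moreover have "finite (?S i)" for i
      by (rule finite_subset[of _ "{int R..4 * int R}"]) auto
    ultimately have "real (card {w\<in>?W. segment_point R j w = p}) = (\<Prod>i\<in>UNIV. real (card (?S i)))"
      by (simp only: card_vec_set(2) of_nat_prod)
    also have "\<dots> \<le> (\<Prod>i\<in>(UNIV::'d set). 4 * real R / real (j + 1))"
    proof (intro prod_mono conjI)
      fix i
      have "real (card (?S i)) * real (j + 1) \<le> 4 * real R"
        using of_nat_mono[OF card_div_fibre[OF j, of "p $ i"], where 'a = real]
        by (simp only: of_nat_mult of_nat_numeral)
      then show "real (card (?S i)) \<le> 4 * real R / real (j + 1)"
        by (rule mult_imp_le_div_pos[rotated]) simp
    qed simp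
    finally show "real (card {w\<in>?W. segment_point R j w = p}) \<le> (4 * real R / real (j + 1)) ^ CARD('d)" by simp
  qed
  finally show ?thesis by (simp add: sum_distrib_left)
qed

text \<open>Sum the segment bound over all endpoints w and exchange the sums. Shifts by e in [0,4]^d
  enlarge [j,4j]^d to [j,4(j+1)]^d and cost 5^d, whence 20 = 4 * 5; the cubes take their final form
  with i = j + 1.\<close>

lemma sum_cube_increments_le:
  fixes u :: "int ^ 'd \<Rightarrow> 'v::real_normed_vector"
  assumes grad: "\<And>m k. norm (u (m - axis k 1) - u m) \<le> \<phi> m"
    and R: "R \<ge> 1"
  shows "(\<Sum>w\<in>int_cube (int R) (4 * int R). norm (u (a + w) - u a)) \<le>
    real R ^ CARD('d) * (20 ^ CARD('d) *
      (\<Sum>i=1..R. (\<Sum>q\<in>int_cube (int i - 1) (4 * int i). \<phi> (a + q)) / real i ^ CARD('d)))"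
proof -
  let ?d = "CARD('d)"
  let ?W = "int_cube (int R) (4 * int R) :: (int ^ 'd) set"
  let ?C = "int_cube 0 4 :: (int ^ 'd) set"
  have pos: "0 \<le> \<phi> m" for m using grad order_trans[OF norm_ge_zero] by blast
  have "(\<Sum>w\<in>?W. norm (u (a + w) - u a)) \<le> (\<Sum>w\<in>?W. \<Sum>j<R. \<Sum>e\<in>?C. \<phi> (a + segment_point R j w + e))"
    by (intro sum_mono segment_path_bound grad R) (auto simp: mem_int_cube intro: order_trans[of 0 "int R"])
  also have "\<dots> = (\<Sum>j<R. \<Sum>w\<in>?W. \<Sum>e\<in>?C. \<phi> (a + segment_point R j w + e))"
    by (rule sum.swap)
  also have "\<dots> \<le> (\<Sum>j<R. (4 * real R / real (j + 1)) ^ ?d *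
      (5 ^ ?d * (\<Sum>q\<in>int_cube (int j) (4 * int (j + 1)). \<phi> (a + q))))"
  proof (intro sum_mono)
    fix j assume "j \<in> {..<R}"
    then have j: "j < R" by simp
    have "(\<Sum>w\<in>?W. \<Sum>e\<in>?C. \<phi> (a + segment_point R j w + e)) \<le>
      (4 * real R / real (j + 1)) ^ ?d * (\<Sum>p\<in>int_cube (int j) (4 * int j). \<Sum>e\<in>?C. \<phi> (a + p + e))"
      using sum_segment_point_le[OF j, of "\<lambda>p. \<Sum>e\<in>?C. \<phi> (a + p + e)"] by (simp add: sum_nonneg pos)
    also have "(\<Sum>p\<in>int_cube (int j) (4 * int j). \<Sum>e\<in>?C. \<phi> (a + p + e)) =
        (\<Sum>e\<in>?C. \<Sum>p\<in>int_cube (int j) (4 * int j). \<phi> (a + (e + p)))"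
      by (subst sum.swap) (simp add: add_ac)
    also have "\<dots> \<le> (\<Sum>e\<in>?C. \<Sum>q\<in>int_cube (int j) (4 * int (j + 1)). \<phi> (a + q))"
    proof (intro sum_mono sum_translate_le)
      fix e p :: "int ^ 'd" assume "e \<in> ?C" "p \<in> int_cube (int j) (4 * int j)"
      then have "0 \<le> e $ i \<and> e $ i \<le> 4 \<and> int j \<le> p $ i \<and> p $ i \<le> 4 * int j" for i
        by (simp add: mem_int_cube)
      then show "e + p \<in> int_cube (int j) (4 * int (j + 1))"
        by (simp add: mem_int_cube) (smt (verit))
    qed (auto simp: pos)
    also have "\<dots> = 5 ^ ?d * (\<Sum>q\<in>int_cube (int j) (4 * int (j + 1)). \<phi> (a + q))"
      by (simp add: card_int_cube)
    finally show "(\<Sum>w\<in>?W. \<Sum>e\<in>?C. \<phi> (a + segment_point R j w + e)) \<le> (4 * real R / real (j + 1)) ^ ?d *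
      (5 ^ ?d * (\<Sum>q\<in>int_cube (int j) (4 * int (j + 1)). \<phi> (a + q)))"
      by (simp add: mult_left_mono)
  qed
  also have "\<dots> = (\<Sum>j<R. real R ^ ?d * (20 ^ ?d * ((\<Sum>q\<in>int_cube (int j) (4 * int (j + 1)). \<phi> (a + q)) / real (j + 1) ^ ?d)))"
  proof (intro sum.cong refl)
    fix j
    have "(20::real) ^ ?d = 4 ^ ?d * 5 ^ ?d" by (simp flip: power_mult_distrib)
    then show "(4 * real R / real (j + 1)) ^ ?d * (5 ^ ?d * (\<Sum>q\<in>int_cube (int j) (4 * int (j + 1)). \<phi> (a + q)))
      = real R ^ ?d * (20 ^ ?d * ((\<Sum>q\<in>int_cube (int j) (4 * int (j + 1)). \<phi> (a + q)) / real (j + 1) ^ ?d))"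
      by (simp add: power_mult_distrib power_divide)
  qed
  also have "\<dots> = real R ^ ?d * (20 ^ ?d * (\<Sum>j<R. (\<Sum>q\<in>int_cube (int j) (4 * int (j + 1)). \<phi> (a + q)) / real (j + 1) ^ ?d))"
    by (simp add: sum_distrib_left)
  also have "(\<Sum>j<R. (\<Sum>q\<in>int_cube (int j) (4 * int (j + 1)). \<phi> (a + q)) / real (j + 1) ^ ?d) =
    (\<Sum>i=1..R. (\<Sum>q\<in>int_cube (int i - 1) (4 * int i). \<phi> (a + q)) / real i ^ ?d)"
    by (rule sum.reindex_bij_witness[of _ "\<lambda>i. i - 1" Suc]) auto
  finally show ?thesis .
qed

text \<open>Average the triangle inequality through u(v) over v in [2R,3R]^d. Since the coordinates
  of n are at most R in absolute value, both v and v - n lie in [R,4R]^d, so the increments from 0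
  and from n are controlled by the same averaged bound.\<close>

lemma lattice_potential_estimate:
  fixes u :: "int ^ 'd \<Rightarrow> 'v::real_normed_vector"
  assumes grad: "\<And>m k. norm (u (m - axis k 1) - u m) \<le> \<phi> m"
    and R: "R \<ge> 1" and n: "n \<in> int_cube (- int R) (int R)"
  shows "norm (u n - u 0) \<le> 20 ^ CARD('d) *
      ((\<Sum>i=1..R. (\<Sum>q\<in>int_cube (int i - 1) (4 * int i). \<phi> q) / real i ^ CARD('d)) +
       (\<Sum>i=1..R. (\<Sum>q\<in>int_cube (int i - 1) (4 * int i). \<phi> (n + q)) / real i ^ CARD('d)))"
proof -
  let ?d = "CARD('d)"
  let ?W = "int_cube (int R) (4 * int R) :: (int ^ 'd) set"
  let ?V = "int_cube (2 * int R) (3 * int R) :: (int ^ 'd) set"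
  let ?K = "\<lambda>a. \<Sum>i=1..R. (\<Sum>q\<in>int_cube (int i - 1) (4 * int i). \<phi> (a + q)) / real i ^ CARD('d)"
  have "real R ^ ?d * norm (u n - u 0) \<le> real (card ?V) * norm (u n - u 0)"
  proof (rule mult_right_mono)
    \<comment> \<open>There are (R+1)^d intermediate points v, which absorbs the factor R^d of the
      averaged bound.\<close>
    have "R ^ ?d \<le> card ?V" unfolding card_int_cube by (intro power_mono) auto
    then show "real R ^ ?d \<le> real (card ?V)" by (metis of_nat_le_iff of_nat_power)
  qed simp
  also have "\<dots> = (\<Sum>v\<in>?V. norm (u n - u 0))" by simp
  also have "\<dots> \<le> (\<Sum>v\<in>?V. norm (u (n + (- n + v)) - u n) + norm (u (0 + v) - u 0))"
  proof (rule sum_mono)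
    fix v
    show "norm (u n - u 0) \<le> norm (u (n + (- n + v)) - u n) + norm (u (0 + v) - u 0)"
      using norm_triangle_ineq4[of "u v - u 0" "u v - u n"] by simp
  qed
  also have "\<dots> = (\<Sum>v\<in>?V. norm (u (n + (- n + v)) - u n)) + (\<Sum>v\<in>?V. norm (u (0 + v) - u 0))"
    by (rule sum.distrib)
  also have "\<dots> \<le> (\<Sum>w\<in>?W. norm (u (n + w) - u n)) + (\<Sum>w\<in>?W. norm (u (0 + w) - u 0))"
  proof (rule add_mono)
    show "(\<Sum>v\<in>?V. norm (u (n + (- n + v)) - u n)) \<le> (\<Sum>w\<in>?W. norm (u (n + w) - u n))"
    proof (rule sum_translate_le)
      fix v assume "v \<in> ?V"
      then show "- n + v \<in> ?W" using n by (simp add: mem_int_cube) (smt (verit))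
    qed auto
    show "(\<Sum>v\<in>?V. norm (u (0 + v) - u 0)) \<le> (\<Sum>w\<in>?W. norm (u (0 + w) - u 0))"
    proof (rule sum_mono2)
      show "?V \<subseteq> ?W" by (rule int_cube_mono) auto
    qed auto
  qed
  also have "\<dots> \<le> real R ^ ?d * (20 ^ ?d * ?K n) + real R ^ ?d * (20 ^ ?d * ?K 0)"
    by (intro add_mono sum_cube_increments_le grad R)
  finally have "real R ^ ?d * norm (u n - u 0) \<le> real R ^ ?d * (20 ^ ?d * (?K 0 + ?K n))"
    by (simp add: algebra_simps)
  then show ?thesis using R by simp
qed

section \<open>Splitting the potential at a level-dependent scale\<close>

text \<open>For i \<le> r the trivial bound (5i)^d on the cube is used, for at most r indices. For i
  > r one has 1/i^d \<le> 1/(r^(d-1) i), and after exchanging sums each point receives at most 8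
  from the weights 1/i: a coordinate z of the point forces z/4 \<le> i \<le> z + 1.\<close>

lemma sum_card_cubes_le:
  fixes A :: "(int ^ 'd) set"
  assumes r: "r > 0"
  shows "(\<Sum>i=1..R. real (card (int_cube (int i - 1) (4 * int i) \<inter> A)) / real i ^ CARD('d)) \<le>
    5 ^ CARD('d) * r + 8 / r ^ (CARD('d) - 1) * real (card (int_cube 0 (4 * int R) \<inter> A))"
proof -
  let ?d = "CARD('d)"
  let ?Q = "\<lambda>i::nat. int_cube (int i - 1) (4 * int i) :: (int ^ 'd) set"
  let ?C = "int_cube 0 (4 * int R) :: (int ^ 'd) set"
  have d: "real i ^ ?d = real i * real i ^ (?d - 1)" for i
    by (metis Suc_pred' power_Suc zero_less_card_finite)
  have "(\<Sum>i=1..R. real (card (?Q i \<inter> A)) / real i ^ ?d) \<le>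
     (\<Sum>i=1..R. (if real i \<le> r then 5 ^ ?d else 0) + 1 / r ^ (?d - 1) * (real (card (?Q i \<inter> A)) / real i))"
  proof (rule sum_mono)
    fix i assume "i \<in> {1..R}"
    then have i: "i \<ge> 1" by simp
    have nn: "0 \<le> 1 / r ^ (?d - 1) * (real (card (?Q i \<inter> A)) / real i)" using r by simp
    show "real (card (?Q i \<inter> A)) / real i ^ ?d \<le>
      (if real i \<le> r then 5 ^ ?d else 0) + 1 / r ^ (?d - 1) * (real (card (?Q i \<inter> A)) / real i)"
    proof (cases "real i \<le> r")
      case True
      have "card (?Q i \<inter> A) \<le> card (?Q i)" by (intro card_mono) auto
      also have "\<dots> \<le> (5 * i) ^ ?d" unfolding card_int_cube using i by (intro power_mono) auto
      finally have "real (card (?Q i \<inter> A)) \<le> 5 ^ ?d * real i ^ ?d"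
        by (metis of_nat_le_iff of_nat_power of_nat_mult of_nat_numeral power_mult_distrib)
      then have "real (card (?Q i \<inter> A)) / real i ^ ?d \<le> 5 ^ ?d"
        using i by (simp add: divide_le_eq)
      then show ?thesis using True nn by (simp only: if_True)
    next
      case False
      then have "r ^ (?d - 1) \<le> real i ^ (?d - 1)" using r by (intro power_mono) auto
      then have "real (card (?Q i \<inter> A)) / (real i * real i ^ (?d - 1)) \<le> real (card (?Q i \<inter> A)) / (real i * r ^ (?d - 1))"
        using r i by (intro divide_left_mono mult_left_mono) auto
      then show ?thesis using False by (simp add: d mult_ac)
    qed
  qed
  also have "\<dots> = (\<Sum>i=1..R. if real i \<le> r then 5 ^ ?d else 0) +
      1 / r ^ (?d - 1) * (\<Sum>i=1..R. real (card (?Q i \<inter> A)) / real i)"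
    by (simp add: sum.distrib sum_distrib_left)
  also have "(\<Sum>i=1..R. if real i \<le> r then 5 ^ ?d else 0) \<le> 5 ^ ?d * r"
  proof -
    have "(\<Sum>i=1..R. if real i \<le> r then (5::real) ^ ?d else 0) = 5 ^ ?d * real (card ({1..R} \<inter> {i. real i \<le> r}))"
      by (simp add: sum.If_cases)
    moreover have "card ({1..R} \<inter> {i. real i \<le> r}) \<le> card {1..nat \<lfloor>r\<rfloor>}"
      by (intro card_mono) (auto simp: le_nat_floor)
    then have "real (card ({1..R} \<inter> {i. real i \<le> r})) \<le> r"
      using r by simp linarith
    ultimately show ?thesis by simp
  qed
  also have "(\<Sum>i=1..R. real (card (?Q i \<inter> A)) / real i) \<le> 8 * real (card (?C \<inter> A))"
  proof -
    have "(\<Sum>i=1..R. real (card (?Q i \<inter> A)) / real i) = (\<Sum>i=1..R. \<Sum>q\<in>?C \<inter> A. if q \<in> ?Q i then 1 / real i else 0)"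
    proof (rule sum.cong)
      fix i assume "i \<in> {1..R}"
      then have "?Q i \<subseteq> ?C" by (intro int_cube_mono) auto
      then have "?C \<inter> A \<inter> ?Q i = ?Q i \<inter> A" by blast
      then show "real (card (?Q i \<inter> A)) / real i = (\<Sum>q\<in>?C \<inter> A. if q \<in> ?Q i then 1 / real i else 0)"
        by (simp add: sum.If_cases)
    qed simp
    also have "\<dots> = (\<Sum>q\<in>?C \<inter> A. \<Sum>i=1..R. if q \<in> ?Q i then 1 / real i else 0)"
      by (rule sum.swap)
    also have "\<dots> \<le> (\<Sum>q\<in>?C \<inter> A. 8)"
    proof (rule sum_mono)
      fix q :: "int ^ 'd" assume "q \<in> ?C \<inter> A"
      \<comment> \<open>\<open>undefined\<close> merely names some coordinate; any one gives the
        needed range of i.\<close>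
      then have z: "q $ undefined \<ge> 0" (is "?z \<ge> 0") by (simp add: mem_int_cube)
      define I where "I = {1..R} \<inter> {i. q \<in> ?Q i}"
      have I: "1 \<le> i \<and> int i \<le> ?z + 1 \<and> ?z \<le> 4 * int i" if "i \<in> I" for i
        using that by (auto simp: I_def mem_int_cube dest: spec[of _ undefined])
      have "(\<Sum>i=1..R. if q \<in> ?Q i then 1 / real i else 0) = (\<Sum>i\<in>I. 1 / real i)"
        by (simp add: sum.If_cases I_def)
      also have "\<dots> \<le> (\<Sum>i\<in>I. 8 / (real_of_int ?z + 1))"
      proof (rule sum_mono)
        fix i assume "i \<in> I"
        \<comment> \<open>From z \<le> 4i and i \<ge> 1, z + 1 \<le> 4i + 1 \<le> 8i. With at most z
          + 1 indices the total is 8.\<close>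
        then have "real_of_int ?z + 1 \<le> 8 * real i" "i \<ge> 1" using I[of i] by linarith+
        then show "1 / real i \<le> 8 / (real_of_int ?z + 1)" using z by (simp add: field_simps)
      qed
      also have "\<dots> = real (card I) * (8 / (real_of_int ?z + 1))" by simp
      also have "\<dots> \<le> (real_of_int ?z + 1) * (8 / (real_of_int ?z + 1))"
      proof (rule mult_right_mono)
        have "I \<subseteq> {1..nat (?z + 1)}" using I by force
        then have "card I \<le> card {1..nat (?z + 1)}" by (intro card_mono) auto
        then show "real (card I) \<le> real_of_int ?z + 1" using z by simp
      qed (use z in simp)
      also have "\<dots> = 8"
      proof -
        have "real_of_int ?z + 1 \<noteq> 0" using z by linarith
        then show ?thesis by (simp add: divide_eq_eq)
      qed
      finally show "(\<Sum>i=1..R. if q \<in> ?Q i then 1 / real i else 0) \<le> 8" .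
    qed
    finally show ?thesis by (simp add: mult.commute)
  qed
  finally show ?thesis using r by (simp add: mult_left_mono divide_right_mono)
qed

text \<open>Where \<^term>\<open>\<tau> t = 0\<close> the integrand is junk (0, or 1 if \<^term>\<open>d = 1\<close>); for the \<open>\<tau>\<close> used here this happens
  only at levels \<^term>\<open>t\<close> above the essential supremum of the function.\<close>
definition weighted_level :: "(real \<Rightarrow> real) \<Rightarrow> nat \<Rightarrow> real \<Rightarrow> ennreal" where
  "weighted_level \<tau> d y = (\<integral>\<^sup>+t. indicator {0<..<y} t * ennreal (1 / \<tau> t ^ (d - 1)) \<partial>lborel)"

text \<open>Layer cake: the potential of \<open>\<phi>\<close> is the integral over t of the
  potentials of its level sets. Each level is cut at its own radius
  \<open>\<rho> * \<tau> t\<close>, which \<open>\<tau>_pos\<close> makes positive whenever the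
  level set is nonempty.\<close>

lemma potential_le_weighted_levels:
  fixes \<phi> :: "int ^ 'd \<Rightarrow> real"
  assumes \<tau> [measurable]: "\<tau> \<in> borel_measurable borel" and \<tau>_pos: "\<And>q t. 0 < t \<Longrightarrow> t < \<phi> q \<Longrightarrow> 0 < \<tau> t"
    and \<tau>_nonneg: "\<And>t. 0 \<le> \<tau> t" and \<phi>: "\<And>q. 0 \<le> \<phi> q" and \<rho>: "\<rho> > 0"
  shows "ennreal (\<Sum>i=1..R. (\<Sum>q\<in>int_cube (int i - 1) (4 * int i). \<phi> q) / real i ^ CARD('d)) \<le>
    ennreal (5 ^ CARD('d) * \<rho>) * (\<integral>\<^sup>+t. indicator {0<..} t * ennreal (\<tau> t) \<partial>lborel) +
    ennreal (8 / \<rho> ^ (CARD('d) - 1)) * (\<Sum>q\<in>int_cube 0 (4 * int R). weighted_level \<tau> CARD('d) (\<phi> q))"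
proof -
  let ?d = "CARD('d)"
  let ?Q = "\<lambda>i::nat. int_cube (int i - 1) (4 * int i) :: (int ^ 'd) set"
  let ?C = "int_cube 0 (4 * int R) :: (int ^ 'd) set"
  have "ennreal (\<Sum>i=1..R. (\<Sum>q\<in>?Q i. \<phi> q) / real i ^ ?d) =
      (\<Sum>i=1..R. \<Sum>q\<in>?Q i. ennreal (1 / real i ^ ?d) * ennreal (\<phi> q))"
    by (simp add: sum_divide_distrib sum_nonneg \<phi> flip: sum_ennreal ennreal_mult)
  \<comment> \<open>Each value of \<open>\<phi>\<close> is written as the length of the interval of
    levels below it.\<close>
  also have "\<dots> = (\<Sum>i=1..R. \<Sum>q\<in>?Q i. \<integral>\<^sup>+t. ennreal (1 / real i ^ ?d) * indicator {0<..<\<phi> q} t \<partial>lborel)"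
    by (simp add: nn_integral_cmult \<phi>)
  also have "\<dots> = (\<integral>\<^sup>+t. (\<Sum>i=1..R. \<Sum>q\<in>?Q i. ennreal (1 / real i ^ ?d) * indicator {0<..<\<phi> q} t) \<partial>lborel)"
    by (subst nn_integral_sum, measurable, intro sum.cong refl, subst nn_integral_sum, measurable)
  also have "\<dots> \<le> (\<integral>\<^sup>+t. ennreal (5 ^ ?d * \<rho>) * (indicator {0<..} t * ennreal (\<tau> t)) +
     ennreal (8 / \<rho> ^ (?d - 1)) * (\<Sum>q\<in>?C. indicator {0<..<\<phi> q} t * ennreal (1 / \<tau> t ^ (?d - 1))) \<partial>lborel)"
  proof (rule nn_integral_mono)
    fix t :: real
    define A where "A = {q. t < \<phi> q}"
    show "(\<Sum>i=1..R. \<Sum>q\<in>?Q i. ennreal (1 / real i ^ ?d) * indicator {0<..<\<phi> q} t) \<le>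
      ennreal (5 ^ ?d * \<rho>) * (indicator {0<..} t * ennreal (\<tau> t)) +
     ennreal (8 / \<rho> ^ (?d - 1)) * (\<Sum>q\<in>?C. indicator {0<..<\<phi> q} t * ennreal (1 / \<tau> t ^ (?d - 1)))"
    proof (cases "0 < t \<and> A \<noteq> {}")
      case False
      then have "indicator {0<..<\<phi> q} t = (0::ennreal)" for q
        by (auto simp: A_def indicator_def)
      then show ?thesis by simp
    next
      case True
      then have t: "0 < t" and \<tau>t: "0 < \<tau> t" using \<tau>_pos by (auto simp: A_def)
      have ind: "(\<Sum>q\<in>Q. b * indicator {0<..<\<phi> q} t) = b * ennreal (real (card (Q \<inter> A)))"
        if "finite Q" for b and Q :: "(int ^ 'd) set"
      proof -
        have "(\<Sum>q\<in>Q. indicator {0<..<\<phi> q} t) = (\<Sum>q\<in>Q. if q \<in> A then 1 else (0::ennreal))"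
          using t by (intro sum.cong) (auto simp: A_def indicator_def)
        also have "\<dots> = ennreal (real (card (Q \<inter> A)))"
          using that by (simp add: sum.If_cases ennreal_of_nat_eq_real_of_nat)
        finally show ?thesis by (simp flip: sum_distrib_left)
      qed
      have "(\<Sum>i=1..R. \<Sum>q\<in>?Q i. ennreal (1 / real i ^ ?d) * indicator {0<..<\<phi> q} t) =
         (\<Sum>i=1..R. ennreal (1 / real i ^ ?d) * ennreal (real (card (?Q i \<inter> A))))"
        by (simp only: ind finite_int_cube)
      also have "\<dots> = ennreal (\<Sum>i=1..R. real (card (?Q i \<inter> A)) / real i ^ ?d)"
        by (simp flip: sum_ennreal ennreal_mult)
      also have "\<dots> \<le> ennreal (5 ^ ?d * (\<rho> * \<tau> t) + 8 / (\<rho> * \<tau> t) ^ (?d - 1) * real (card (?C \<inter> A)))"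
        using \<rho> \<tau>t by (intro ennreal_leI sum_card_cubes_le) simp
      also have "\<dots> = ennreal (5 ^ ?d * \<rho>) * ennreal (\<tau> t) +
          ennreal (8 / \<rho> ^ (?d - 1)) * (ennreal (1 / \<tau> t ^ (?d - 1)) * ennreal (real (card (?C \<inter> A))))"
        using \<rho> \<tau>t by (simp add: power_mult_distrib mult_ac flip: ennreal_mult ennreal_plus)
      also have "\<dots> = ennreal (5 ^ ?d * \<rho>) * (indicator {0<..} t * ennreal (\<tau> t)) +
          ennreal (8 / \<rho> ^ (?d - 1)) * (\<Sum>q\<in>?C. indicator {0<..<\<phi> q} t * ennreal (1 / \<tau> t ^ (?d - 1)))"
        using t by (simp add: ind[symmetric] mult.commute)
      finally show ?thesis .
    qed
  qed
  also have "\<dots> = ennreal (5 ^ ?d * \<rho>) * (\<integral>\<^sup>+t. indicator {0<..} t * ennreal (\<tau> t) \<partial>lborel) +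
     ennreal (8 / \<rho> ^ (?d - 1)) * (\<Sum>q\<in>?C. weighted_level \<tau> ?d (\<phi> q))"
    unfolding weighted_level_def
    by (subst nn_integral_add, measurable, subst nn_integral_cmult, measurable,
        subst nn_integral_cmult, measurable, subst nn_integral_sum, measurable)
  finally show ?thesis .
qed

section \<open>Tail measures and the Lorentz norm\<close>

lemma (in finite_measure) tail_measure_powr_measurable:
  fixes f :: "'a \<Rightarrow> real"
  assumes [measurable]: "f \<in> borel_measurable M"
  shows "(\<lambda>t. measure M {x \<in> space M. t < f x} powr a) \<in> borel_measurable borel"
proof -
  have "mono (\<lambda>t. - measure M {x \<in> space M. t < f x})"
    by (intro monoI) (auto intro!: finite_measure_mono)
  then have "(\<lambda>t. - measure M {x \<in> space M. t < f x}) \<in> borel_measurable borel"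
    by (rule borel_measurable_mono)
  then have [measurable]: "(\<lambda>t. measure M {x \<in> space M. t < f x}) \<in> borel_measurable borel"
    by (simp add: borel_measurable_uminus_eq)
  show ?thesis by measurable
qed

text \<open>Almost every value of f is at most its essential supremum. The uncountably many levels
  reduce to rational ones: if t < q < f x with q rational, then {f > q} is contained in {f > t}, so
  discarding the null sets {f > q} suffices.\<close>

lemma (in finite_measure) AE_tail_measure_pos:
  fixes f :: "'a \<Rightarrow> real"
  assumes [measurable]: "f \<in> borel_measurable M"
  shows "AE x in M. \<forall>t. t < f x \<longrightarrow> 0 < measure M {y \<in> space M. t < f y}"
proof -
  have "AE x in M. \<forall>q::rat. measure M {y \<in> space M. of_rat q < f y} = 0 \<longrightarrow> \<not> of_rat q < f x"
  proof (subst AE_all_countable, intro allI)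
    fix q :: rat
    show "AE x in M. measure M {y \<in> space M. of_rat q < f y} = 0 \<longrightarrow> \<not> of_rat q < f x"
    proof (cases "measure M {y \<in> space M. of_rat q < f y} = 0")
      case True
      then have "{y \<in> space M. of_rat q < f y} \<in> null_sets M"
        by (simp add: null_sets_def emeasure_eq_measure)
      from AE_not_in[OF this] show ?thesis using AE_space by eventually_elim auto
    qed simp
  qed
  then show ?thesis
  proof eventually_elim
    case (elim x)
    show ?case
    proof (intro allI impI)
      fix t assume "t < f x"
      then obtain q where q: "t < of_rat q" "of_rat q < f x" using of_rat_dense by blast
      then have "0 < measure M {y \<in> space M. of_rat q < f y}"
        using elim by (metis less_eq_real_def measure_nonneg)
      also have "\<dots> \<le> measure M {y \<in> space M. t < f y}"
        using q(1) by (intro finite_measure_mono) auto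
      finally show "0 < measure M {y \<in> space M. t < f y}" .
    qed
  qed
qed

text \<open>By Tonelli the level t contributes mu(f > t) / \<open>\<tau> t\<close>^(d-1). Since mu(f
  > t) = \<open>\<tau> t\<close>^d, this is \<open>\<tau> t\<close>; the root 1/d in
  \<open>\<tau>\<close> is chosen for this.\<close>

lemma (in finite_measure) weighted_level_integral:
  fixes f :: "'a \<Rightarrow> real"
  assumes f [measurable]: "f \<in> borel_measurable M" and d: "d \<ge> 1"
  defines "\<tau> \<equiv> \<lambda>t. measure M {x \<in> space M. t < f x} powr (1 / real d)"
  shows "(\<lambda>x. weighted_level \<tau> d (f x)) \<in> borel_measurable M"
    and "(\<integral>\<^sup>+x. weighted_level \<tau> d (f x) \<partial>M) \<le> (\<integral>\<^sup>+t. indicator {0<..} t * ennreal (\<tau> t) \<partial>lborel)"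
proof -
  have [measurable]: "\<tau> \<in> borel_measurable borel"
    unfolding \<tau>_def by (rule tail_measure_powr_measurable) fact
  have \<tau>_nonneg [simp]: "0 \<le> \<tau> t" for t by (simp add: \<tau>_def)
  interpret P: pair_sigma_finite M lborel ..
  have eq: "weighted_level \<tau> d (f x) = (\<integral>\<^sup>+t. (if 0 < t \<and> t < f x then ennreal (1 / \<tau> t ^ (d - 1)) else 0) \<partial>lborel)" for x
    unfolding weighted_level_def by (intro nn_integral_cong) (auto simp: indicator_def)
  show "(\<lambda>x. weighted_level \<tau> d (f x)) \<in> borel_measurable M"
    unfolding eq by measurable
  have "(\<integral>\<^sup>+x. weighted_level \<tau> d (f x) \<partial>M) =
     (\<integral>\<^sup>+t. \<integral>\<^sup>+x. (if 0 < t \<and> t < f x then ennreal (1 / \<tau> t ^ (d - 1)) else 0) \<partial>M \<partial>lborel)"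
    unfolding eq by (rule P.Fubini'[symmetric]) measurable
  also have "\<dots> \<le> (\<integral>\<^sup>+t. indicator {0<..} t * ennreal (\<tau> t) \<partial>lborel)"
  proof (rule nn_integral_mono)
    fix t :: real
    let ?A = "{x \<in> space M. t < f x}"
    show "(\<integral>\<^sup>+x. (if 0 < t \<and> t < f x then ennreal (1 / \<tau> t ^ (d - 1)) else 0) \<partial>M) \<le> indicator {0<..} t * ennreal (\<tau> t)"
    proof (cases "0 < t")
      case True
      then have "(\<integral>\<^sup>+x. (if 0 < t \<and> t < f x then ennreal (1 / \<tau> t ^ (d - 1)) else 0) \<partial>M) =
        (\<integral>\<^sup>+x. ennreal (1 / \<tau> t ^ (d - 1)) * indicator ?A x \<partial>M)"
        by (intro nn_integral_cong) (auto simp: indicator_def)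
      also have "\<dots> = ennreal (1 / \<tau> t ^ (d - 1) * measure M ?A)"
        by (simp add: nn_integral_cmult emeasure_eq_measure flip: ennreal_mult)
      also have "measure M ?A = \<tau> t * \<tau> t ^ (d - 1)"
      proof -
        have "\<tau> t ^ d = measure M ?A"
          unfolding \<tau>_def using d by (cases "measure M ?A = 0") (simp_all add: powr_power)
        then show ?thesis using d by (metis Suc_pred' less_eq_Suc_le One_nat_def power_Suc)
      qed
      also have "ennreal (1 / \<tau> t ^ (d - 1) * (\<tau> t * \<tau> t ^ (d - 1))) \<le> ennreal (\<tau> t)"
        \<comment> \<open>If the power vanishes, division by zero gives 0 and the left side is
          0.\<close>
        by (cases "\<tau> t ^ (d - 1) = 0") (auto simp: \<tau>_def)
      finally show ?thesis using True by simp
    qed simp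
  qed
  finally show "(\<integral>\<^sup>+x. weighted_level \<tau> d (f x) \<partial>M) \<le> (\<integral>\<^sup>+t. indicator {0<..} t * ennreal (\<tau> t) \<partial>lborel)" .
qed

text \<open>Both sides are compared with the double integral of t^(1/p-1) over 0 < t < mu(|f| > s),
  s > 0. Integrating in t first bounds it below by the tail integral; integrating in s first bounds
  it above by the Lorentz norm.\<close>

lemma (in finite_measure) integral_tail_powr_le_lorentz_norm:
  fixes f :: "'a \<Rightarrow> real"
  assumes f [measurable]: "f \<in> borel_measurable M" and p: "p \<ge> 1"
  shows "(\<integral>\<^sup>+s. indicator {0<..} s * ennreal (measure M {x \<in> space M. s < \<bar>f x\<bar>} powr (1 / p)) \<partial>lborel)
    \<le> lorentz_norm_p1 M p f"
proof -
  define \<mu> where "\<mu> s = measure M {x \<in> space M. s < \<bar>f x\<bar>}" for s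
  have \<mu>: "distrib_fun M f s = ennreal (\<mu> s)" for s
    by (simp add: distrib_fun_def \<mu>_def emeasure_eq_measure)
  have [measurable]: "\<mu> \<in> borel_measurable borel"
  proof -
    have "(\<lambda>t. \<mu> t powr 1) \<in> borel_measurable borel"
      unfolding \<mu>_def by (rule tail_measure_powr_measurable) measurable
    moreover have "(\<lambda>t. \<mu> t powr 1) = \<mu>" by (rule ext) (simp add: \<mu>_def)
    ultimately show ?thesis by simp
  qed
  let ?F = "\<lambda>t s. if 0 < t \<and> 0 < s \<and> t < \<mu> s then ennreal (t powr (1 / p) / t) else 0"
  have "(\<integral>\<^sup>+s. indicator {0<..} s * ennreal (\<mu> s powr (1 / p)) \<partial>lborel) \<le> (\<integral>\<^sup>+s. \<integral>\<^sup>+t. ?F t s \<partial>lborel \<partial>lborel)"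
  proof (rule nn_integral_mono)
    fix s :: real
    show "indicator {0<..} s * ennreal (\<mu> s powr (1 / p)) \<le> (\<integral>\<^sup>+t. ?F t s \<partial>lborel)"
    proof (cases "0 < s \<and> 0 < \<mu> s")
      case False
      moreover have "0 \<le> \<mu> s" by (simp add: \<mu>_def)
      ultimately have "\<mu> s = 0 \<or> \<not> 0 < s" by auto
      then show ?thesis by (auto simp: indicator_def)
    next
      case True
      then have "indicator {0<..} s * ennreal (\<mu> s powr (1 / p)) = ennreal (\<mu> s powr (1 / p) / \<mu> s * \<mu> s)"
        by simp
      also have "\<dots> = (\<integral>\<^sup>+t. ennreal (\<mu> s powr (1 / p) / \<mu> s) * indicator {0<..<\<mu> s} t \<partial>lborel)"
        using True by (subst nn_integral_cmult_indicator) (auto simp flip: ennreal_mult)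
      also have "\<dots> \<le> (\<integral>\<^sup>+t. ?F t s \<partial>lborel)"
      proof (rule nn_integral_mono)
        fix t :: real
        have "\<mu> s powr (1 / p) / \<mu> s \<le> t powr (1 / p) / t" if t: "0 < t" "t < \<mu> s"
        proof -
          \<comment> \<open>As p \<ge> 1, the exponent is nonpositive, so on (0,
            \<open>\<mu> s\<close>) the integrand is at least its value at the right end.\<close>
          have "\<mu> s powr (1 / p - 1) \<le> t powr (1 / p - 1)"
            using t p by (intro powr_mono2') (auto simp: field_simps)
          then show ?thesis using t True by (simp add: powr_diff)
        qed
        then show "ennreal (\<mu> s powr (1 / p) / \<mu> s) * indicator {0<..<\<mu> s} t \<le> ?F t s"
          using True by (auto simp: indicator_def intro!: ennreal_leI)
      qed
      finally show ?thesis .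
    qed
  qed
  also have "\<dots> = (\<integral>\<^sup>+t. \<integral>\<^sup>+s. ?F t s \<partial>lborel \<partial>lborel)"
    by (rule lborel_pair.Fubini') measurable
  also have "\<dots> \<le> lorentz_norm_p1 M p f"
    unfolding lorentz_norm_p1_def
  proof (rule nn_integral_mono)
    fix t :: real
    show "(\<integral>\<^sup>+s. ?F t s \<partial>lborel) \<le> indicator {0<..} t * ennreal (t powr (1 / p) / t) * decr_rearr M f t"
    proof (cases "0 < t")
      case True
      have "(\<integral>\<^sup>+s. ?F t s \<partial>lborel) = (\<integral>\<^sup>+s. ennreal (t powr (1 / p) / t) * indicator {s. 0 < s \<and> t < \<mu> s} s \<partial>lborel)"
        using True by (intro nn_integral_cong) (auto simp: indicator_def)
      also have "\<dots> = ennreal (t powr (1 / p) / t) * emeasure lborel {s. 0 < s \<and> t < \<mu> s}"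
        by (subst nn_integral_cmult_indicator) auto
      \<comment> \<open>The tail is antitone, so every s0 admissible in the infimum defining f*(t)
        bounds this set of levels.\<close>
      also have "emeasure lborel {s. 0 < s \<and> t < \<mu> s} \<le> decr_rearr M f t"
        unfolding decr_rearr_def
      proof (rule Inf_greatest, safe)
        fix s0 :: real assume s0: "0 < s0" "distrib_fun M f s0 \<le> ennreal t"
        then have "\<mu> s0 \<le> t" using True by (simp add: \<mu>)
        have "{s. 0 < s \<and> t < \<mu> s} \<subseteq> {0<..s0}"
        proof safe
          fix s assume s: "0 < s" "t < \<mu> s"
          have "\<mu> s \<le> \<mu> s0" if "s0 \<le> s"
            unfolding \<mu>_def using that by (intro finite_measure_mono) auto
          then show "s \<in> {0<..s0}" using s \<open>\<mu> s0 \<le> t\<close> by fastforce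
        qed
        then have "emeasure lborel {s. 0 < s \<and> t < \<mu> s} \<le> emeasure lborel {0<..s0}"
          by (intro emeasure_mono) auto
        then show "emeasure lborel {s. 0 < s \<and> t < \<mu> s} \<le> ennreal s0" using s0 by simp
      qed
      finally show ?thesis using True by (simp add: mult_left_mono)
    qed simp
  qed
  finally show ?thesis by (simp add: \<mu>_def)
qed

section \<open>Comparison with the Euclidean norm\<close>

text \<open>The function N is Lipschitz for the Euclidean norm, so it attains a minimum on the
  compact unit sphere; this minimum is positive and serves as c by homogeneity.\<close>

lemma is_norm_on_lower_bound:
  fixes N :: "real ^ 'd \<Rightarrow> real"
  assumes N: "is_norm_on N"
  obtains c where "c > 0" "\<And>x. c * norm x \<le> N x"
proof -
  have NZ: "N 0 = 0" using N by (simp add: is_norm_on_def)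
  have N0: "N x = 0 \<longleftrightarrow> x = 0" and Nadd: "N (x + y) \<le> N x + N y" and Nscale: "N (a *\<^sub>R x) = \<bar>a\<bar> * N x" for x y a
    using N by (auto simp: is_norm_on_def)
  have Nneg: "N (- x) = N x" for x using Nscale[of "-1" x] by simp
  have Nnn: "0 \<le> N x" for x using Nadd[of x "- x"] NZ by (simp add: Nneg)
  have Nsum: "N (\<Sum>i\<in>I. g i) \<le> (\<Sum>i\<in>I. N (g i))" if "finite I" for I and g :: "'d \<Rightarrow> real ^ 'd"
    using that
  proof induction
    case (insert i I)
    then show ?case using Nadd[of "g i" "sum g I"] by simp
  qed (simp add: NZ)
  define K where "K = (\<Sum>i\<in>UNIV. N (axis i 1 :: real ^ 'd))"
  have K: "N x \<le> K * norm x" for x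
  proof -
    have "N x = N (\<Sum>i\<in>UNIV. (x $ i) *\<^sub>R axis i 1)"
      by (metis basis_expansion scalar_mult_eq_scaleR)
    also have "\<dots> \<le> (\<Sum>i\<in>UNIV. \<bar>x $ i\<bar> * N (axis i 1))"
      using Nsum[of UNIV "\<lambda>i. (x $ i) *\<^sub>R axis i 1"] by (simp add: Nscale)
    also have "\<dots> \<le> (\<Sum>i\<in>UNIV. norm x * N (axis i 1))"
      by (intro sum_mono mult_right_mono component_le_norm_cart Nnn)
    finally show ?thesis by (simp add: K_def sum_distrib_left mult.commute)
  qed
  have "\<bar>N x - N y\<bar> \<le> K * dist x y" for x y
    using Nadd[of "x - y" y] Nadd[of "y - x" x] K[of "x - y"] K[of "y - x"]
    by (simp add: dist_norm norm_minus_commute)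
  then have "K-lipschitz_on UNIV N"
    by (intro lipschitz_onI) (auto simp: dist_real_def K_def Nnn sum_nonneg)
  then have cont: "continuous_on (sphere 0 1) N"
    using lipschitz_on_continuous_on continuous_on_subset by blast
  have "sphere (0 :: real ^ 'd) 1 \<noteq> {}" by simp
  then obtain x0 where x0: "x0 \<in> sphere 0 1" "\<And>x. x \<in> sphere 0 1 \<Longrightarrow> N x0 \<le> N x"
    using continuous_attains_inf[OF compact_sphere _ cont] by blast
  have "N x0 * norm x \<le> N x" for x
  proof (cases "x = 0")
    case False
    then have "N x0 \<le> N ((1 / norm x) *\<^sub>R x)" by (intro x0) simp
    then show ?thesis using False by (simp add: Nscale field_simps)
  qed (simp add: NZ)
  moreover have "N x0 > 0" using x0(1) Nnn[of x0] N0[of x0] by (auto simp: less_le)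
  ultimately show ?thesis using that by blast
qed

section \<open>The weak-type estimate\<close>

text \<open>\<open>S\<close> is any positive real bound for the Lorentz norm rather than the norm
  itself: \<open>\<theta>\<close> divides by it, and a vanishing norm is treated later by letting
  \<open>S\<close> tend to 0.\<close>

lemma maximal_function_weak_type:
  fixes M :: "'a measure"
    and T :: "int ^ 'd \<Rightarrow> 'a \<Rightarrow> 'a"
    and u :: "'a \<Rightarrow> int ^ 'd \<Rightarrow> 'v::real_normed_vector"
    and N :: "real ^ 'd \<Rightarrow> real"
  assumes M: "prob_space M" and T: "mp_action M T"
    and f [measurable]: "f \<in> borel_measurable M" and f_nonneg: "\<And>x. 0 \<le> f x"
    and u0: "\<And>x. x \<in> space M \<Longrightarrow> u x 0 = 0"
    and grad: "\<And>x m k. x \<in> space M \<Longrightarrow> norm (u x (m - axis k 1) - u x m) \<le> f (T m x)"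
    and c: "c > 0" and N: "\<And>y. c * norm y \<le> N y"
    and S: "S > 0" "lorentz_norm_p1 M (real CARD('d)) f \<le> ennreal S"
    and lam: "lam > 0"
  shows "emeasure M {x \<in> space M.
           (SUP n\<in>{n. n \<noteq> 0}. ennreal (norm (u x n) / N (int_vec_to_real n))) \<ge> ennreal lam}
     \<le> ennreal ((190 * 100 ^ CARD('d) / c * S / lam) ^ CARD('d))"
proof -
  let ?d = "CARD('d)"
  interpret prob_space M by fact
  have d: "?d \<ge> 1" by (simp add: Suc_leI)
  have Tm [measurable]: "T k \<in> M \<rightarrow>\<^sub>M M" for k using T by (simp add: mp_action_def)
  define \<tau> where "\<tau> = (\<lambda>t. measure M {x \<in> space M. t < f x} powr (1 / real ?d))"
  have \<tau>_meas: "\<tau> \<in> borel_measurable borel"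
    unfolding \<tau>_def by (rule tail_measure_powr_measurable) fact
  have \<tau>_nonneg: "0 \<le> \<tau> t" for t by (simp add: \<tau>_def)
  define h where "h x = weighted_level \<tau> ?d (f x)" for x
  have h_meas [measurable]: "h \<in> borel_measurable M"
    unfolding h_def \<tau>_def by (rule weighted_level_integral(1)[OF f d])
  have \<tau>_int: "(\<integral>\<^sup>+t. indicator {0<..} t * ennreal (\<tau> t) \<partial>lborel) \<le> ennreal S"
    using integral_tail_powr_le_lorentz_norm[OF f, of "real ?d"] d S(2) f_nonneg
    by (simp add: \<tau>_def order_trans)
  have h_int: "(\<integral>\<^sup>+x. h x \<partial>M) \<le> ennreal S"
    unfolding h_def \<tau>_def
    by (rule order_trans[OF weighted_level_integral(2)[OF f d] \<tau>_int[unfolded \<tau>_def]])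

  \<comment> \<open>The factor 19 instead of 18 makes the final bound strictly smaller than \<^term>\<open>lam\<close>.\<close>
  define \<theta> where "\<theta> = lam * c / (19 * 100 ^ ?d * S)"
  have \<theta>: "\<theta> > 0" using lam c S by (simp add: \<theta>_def)
  \<comment> \<open>With this threshold the maximal inequality gives 10^d S /
    \<open>\<alpha>\<close> = (10/\<open>\<theta>\<close>)^d, and off \<open>Bad\<close> the large
    scales contribute a fixed multiple of the bound for the small ones.\<close>
  define \<alpha> where "\<alpha> = \<theta> ^ ?d * S"
  have \<alpha>: "\<alpha> > 0" using \<theta> S by (simp add: \<alpha>_def)
  define Bad where "Bad = {x \<in> space M. \<exists>r\<ge>1. ennreal \<alpha> * of_nat (r ^ ?d) <
            (\<Sum>m\<in>int_cube (- int r) (int r). h (T m x))}"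
  have [measurable]: "Bad \<in> sets M" unfolding Bad_def by measurable
  have Bad: "emeasure M Bad \<le> ennreal ((190 * 100 ^ ?d / c * S / lam) ^ ?d)"
  proof -
    have "ennreal \<alpha> * emeasure M Bad \<le> 10 ^ ?d * (\<integral>\<^sup>+x. h x \<partial>M)"
      unfolding Bad_def by (rule wiener_maximal_inequality[OF T h_meas])
    also have "\<dots> \<le> ennreal (10 ^ ?d) * ennreal S"
      using h_int by (simp add: mult_left_mono flip: ennreal_power)
    also have "\<dots> = ennreal \<alpha> * ennreal ((10 / \<theta>) ^ ?d)"
      using \<theta> S by (simp add: \<alpha>_def power_divide flip: ennreal_mult)
    finally have "emeasure M Bad \<le> ennreal ((10 / \<theta>) ^ ?d)"
      using \<alpha> by (subst (asm) ennreal_mult_le_mult_iff) auto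
    also have "10 / \<theta> = 190 * 100 ^ ?d / c * S / lam"
      using lam c S by (simp add: \<theta>_def field_simps)
    finally show ?thesis .
  qed

  \<comment> \<open>Positivity of the tails is needed along the whole orbit; invariance of the
    measure and countability of Z^d keep the exceptional set null.\<close>
  have "AE x in M. \<forall>k t. t < f (T k x) \<longrightarrow> 0 < measure M {y \<in> space M. t < f y}"
  proof (subst AE_all_countable, intro allI)
    fix k
    have "distr M M (T k) = M" using T by (simp add: mp_action_def)
    then have "AE x in distr M M (T k). \<forall>t. t < f x \<longrightarrow> 0 < measure M {y \<in> space M. t < f y}"
      using AE_tail_measure_pos[OF f] by (simp only:)
    then show "AE x in M. \<forall>t. t < f (T k x) \<longrightarrow> 0 < measure M {y \<in> space M. t < f y}"
      by (rule AE_distrD[OF Tm])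
  qed
  then obtain Z where Z: "{x \<in> space M. \<not> (\<forall>k t. t < f (T k x) \<longrightarrow> 0 < measure M {y \<in> space M. t < f y})} \<subseteq> Z"
    "emeasure M Z = 0" "Z \<in> sets M" by (rule AE_E)

  have good: "norm (u x n) / N (int_vec_to_real n) \<le> 18 / 19 * lam"
    if x: "x \<in> space M" "x \<notin> Bad" "x \<notin> Z" and n: "n \<noteq> 0" for x n
  proof -
    define R where "R = Max (range (\<lambda>i. nat \<bar>n $ i\<bar>))"
    have R_ge: "nat \<bar>n $ i\<bar> \<le> R" for i unfolding R_def by simp
    have "R \<in> range (\<lambda>i. nat \<bar>n $ i\<bar>)" unfolding R_def by (rule Max_in) auto
    then obtain i0 where i0: "R = nat \<bar>n $ i0\<bar>" by blast
    have R: "R \<ge> 1"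
    proof -
      obtain i where "n $ i \<noteq> 0" using n by (auto simp: vec_eq_iff)
      then show ?thesis using R_ge[of i] by simp
    qed
    have n_in: "- int R \<le> n $ i \<and> n $ i \<le> int R" for i using R_ge[of i] by linarith
    define \<rho> where "\<rho> = \<theta> * real R"
    have \<rho>: "\<rho> > 0" using \<theta> R by (simp add: \<rho>_def)
    have potential: "(\<Sum>i=1..R. (\<Sum>q\<in>int_cube (int i - 1) (4 * int i). f (T (a + q) x)) / real i ^ ?d)
        \<le> 9 * 5 ^ ?d * \<theta> * S * real R" (is "?K a \<le> _")
      if a: "\<And>i. - int R \<le> a $ i \<and> a $ i \<le> int R" for a
    proof -
      have pos: "0 < \<tau> t" if "t < f (T (a + q) x)" for q t
      proof -
        have "0 < measure M {y \<in> space M. t < f y}" using Z(1) x that by blast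
        then show ?thesis by (simp add: \<tau>_def)
      qed
      \<comment> \<open>For a = 0 and a = n alike, a + [0,4R]^d lies in the cube of radius 5R about
        the origin, so it suffices that x itself is outside \<open>Bad\<close>.\<close>
      have "(\<Sum>q\<in>int_cube 0 (4 * int R). weighted_level \<tau> ?d (f (T (a + q) x))) \<le>
          (\<Sum>m\<in>int_cube (- int (5 * R)) (int (5 * R)). h (T m x))"
        unfolding h_def
      proof (rule sum_translate_le)
        fix q :: "int ^ 'd" assume "q \<in> int_cube 0 (4 * int R)"
        then have "0 \<le> q $ i \<and> q $ i \<le> 4 * int R" for i by (simp add: mem_int_cube)
        then show "a + q \<in> int_cube (- int (5 * R)) (int (5 * R))"
          using a by (simp add: mem_int_cube) (smt (verit))
      qed auto
      also have "(\<Sum>m\<in>int_cube (- int (5 * R)) (int (5 * R)). h (T m x)) \<le> ennreal \<alpha> * of_nat ((5 * R) ^ ?d)"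
      proof -
        have "5 * R \<ge> 1" using R by simp
        then have "\<not> ennreal \<alpha> * of_nat ((5 * R) ^ ?d) < (\<Sum>m\<in>int_cube (- int (5 * R)) (int (5 * R)). h (T m x))"
          using x(1,2) unfolding Bad_def by blast
        then show ?thesis by (simp only: not_less)
      qed
      also have "\<dots> = ennreal (\<alpha> * (5 * real R) ^ ?d)"
        using \<alpha> by (simp add: ennreal_mult ennreal_of_nat_eq_real_of_nat)
      finally have levels: "(\<Sum>q\<in>int_cube 0 (4 * int R). weighted_level \<tau> ?d (f (T (a + q) x))) \<le>
          ennreal (\<alpha> * (5 * real R) ^ ?d)" .
      have "ennreal (?K a) \<le> ennreal (5 ^ ?d * \<rho>) * (\<integral>\<^sup>+t. indicator {0<..} t * ennreal (\<tau> t) \<partial>lborel) +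
        ennreal (8 / \<rho> ^ (?d - 1)) * (\<Sum>q\<in>int_cube 0 (4 * int R). weighted_level \<tau> ?d (f (T (a + q) x)))"
        by (rule potential_le_weighted_levels[OF \<tau>_meas]) (use pos \<tau>_nonneg f_nonneg \<rho> in auto)
      also have "\<dots> \<le> ennreal (5 ^ ?d * \<rho>) * ennreal S + ennreal (8 / \<rho> ^ (?d - 1)) * ennreal (\<alpha> * (5 * real R) ^ ?d)"
        by (intro add_mono mult_left_mono \<tau>_int levels) auto
      also have "\<dots> = ennreal (5 ^ ?d * \<rho> * S + 8 / \<rho> ^ (?d - 1) * (\<alpha> * (5 * real R) ^ ?d))"
        using \<rho> S \<alpha> by (simp flip: ennreal_mult ennreal_plus)
      \<comment> \<open>By the choice of \<open>\<alpha>\<close>, the second term is 8 times the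
        first, and 1 + 8 = 9.\<close>
      also have "5 ^ ?d * \<rho> * S + 8 / \<rho> ^ (?d - 1) * (\<alpha> * (5 * real R) ^ ?d) = 9 * 5 ^ ?d * \<theta> * S * real R"
      proof -
        have "\<alpha> * (5 * real R) ^ ?d = 5 ^ ?d * S * \<rho> ^ ?d"
          by (simp add: \<alpha>_def \<rho>_def power_mult_distrib)
        also have "\<rho> ^ ?d = \<rho> * \<rho> ^ (?d - 1)"
          by (metis Suc_pred' power_Suc zero_less_card_finite)
        finally have eq: "\<alpha> * (5 * real R) ^ ?d = 5 ^ ?d * S * (\<rho> * \<rho> ^ (?d - 1))" .
        have "8 / \<rho> ^ (?d - 1) * (\<alpha> * (5 * real R) ^ ?d) = 8 * 5 ^ ?d * S * \<rho>"
          unfolding eq using \<rho> by simp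
        then show ?thesis by (simp add: \<rho>_def algebra_simps)
      qed
      finally show ?thesis using \<theta> S by (subst (asm) ennreal_le_iff) auto
    qed
    have "norm (u x n - u x 0) \<le> 20 ^ ?d * (?K 0 + ?K n)"
      using lattice_potential_estimate[of "u x" "\<lambda>m. f (T m x)" R n, OF grad[OF x(1)] R] n_in
      by (simp add: mem_int_cube)
    also have "\<dots> \<le> 20 ^ ?d * (9 * 5 ^ ?d * \<theta> * S * real R + 9 * 5 ^ ?d * \<theta> * S * real R)"
      using n_in by (intro mult_left_mono add_mono potential) auto
    \<comment> \<open>The potentials at 0 and at n give 9 + 9 = 18, and 20 * 5 is the base 100 in
      \<open>\<theta>\<close>.\<close>
    also have "\<dots> = 18 * (20 * 5) ^ ?d * \<theta> * S * real R"
      by (simp only: power_mult_distrib) simp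
    also have "\<dots> = 18 / 19 * lam * (c * real R)"
      using S by (simp add: \<theta>_def)
    also have "\<dots> \<le> 18 / 19 * lam * N (int_vec_to_real n)"
    proof (intro mult_left_mono)
      have "real R = \<bar>int_vec_to_real n $ i0\<bar>" by (simp add: i0 int_vec_to_real_def)
      also have "\<dots> \<le> norm (int_vec_to_real n)" by (rule component_le_norm_cart)
      finally have "c * real R \<le> c * norm (int_vec_to_real n)" using c by simp
      then show "c * real R \<le> N (int_vec_to_real n)" using N[of "int_vec_to_real n"] by linarith
    qed (use lam in simp)
    finally have le: "norm (u x n) \<le> 18 / 19 * lam * N (int_vec_to_real n)" using u0 x by simp
    have "0 \<le> N (int_vec_to_real n)"
      using N[of "int_vec_to_real n"] c by (smt (verit) norm_ge_zero mult_nonneg_nonneg)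
    with le lam show ?thesis
      \<comment> \<open>For a zero denominator the quotient is 0 by convention.\<close>
      by (cases "N (int_vec_to_real n) = 0") (simp_all add: divide_le_eq)
  qed
  have "{x \<in> space M. (SUP n\<in>{n. n \<noteq> 0}. ennreal (norm (u x n) / N (int_vec_to_real n))) \<ge> ennreal lam} \<subseteq> Bad \<union> Z"
  proof (rule subsetI, rule ccontr)
    fix x assume "x \<in> {x \<in> space M. (SUP n\<in>{n. n \<noteq> 0}. ennreal (norm (u x n) / N (int_vec_to_real n))) \<ge> ennreal lam}"
      and "x \<notin> Bad \<union> Z"
    then have x: "x \<in> space M" "x \<notin> Bad" "x \<notin> Z"
      and le: "ennreal lam \<le> (SUP n\<in>{n. n \<noteq> 0}. ennreal (norm (u x n) / N (int_vec_to_real n)))" by auto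
    note le
    also have "(SUP n\<in>{n. n \<noteq> 0}. ennreal (norm (u x n) / N (int_vec_to_real n))) \<le> ennreal (18 / 19 * lam)"
      by (intro SUP_least ennreal_leI good x) simp
    finally show False using lam by simp
  qed
  then have "emeasure M {x \<in> space M. (SUP n\<in>{n. n \<noteq> 0}. ennreal (norm (u x n) / N (int_vec_to_real n))) \<ge> ennreal lam}
      \<le> emeasure M (Bad \<union> Z)"
    \<comment> \<open>Monotonicity asks for measurability of the larger set only.\<close>
    using Z(3) by (intro emeasure_mono) auto
  also have "\<dots> \<le> emeasure M Bad + emeasure M Z"
    using Z(3) by (intro emeasure_subadditive) auto
  finally show ?thesis using Bad Z(2) by simp
qed

section \<open>Passage to the cocycle and the case of zero norm\<close>

lemma ennreal_le_zero_of_le_power: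
  fixes y :: ennreal
  assumes K: "K > 0" and d: "d \<ge> 1" and y: "\<And>\<epsilon>. \<epsilon> > 0 \<Longrightarrow> y \<le> ennreal ((K * \<epsilon>) ^ d)"
  shows "y = 0"
proof -
  have "y \<le> 0 + ennreal e" if e: "e > 0" for e
  proof -
    \<comment> \<open>Capping at 1 ensures that the d-th power of \<open>e'\<close> is at most
      \<open>e'\<close>.\<close>
    define e' where "e' = min e 1"
    have e': "0 < e'" "e' \<le> 1" "e' \<le> e" using e by (auto simp: e'_def)
    have "y \<le> ennreal ((K * (e' / K)) ^ d)" using e' K by (intro y) simp
    also have "\<dots> \<le> ennreal e"
    proof (rule ennreal_leI)
      have "(K * (e' / K)) ^ d = e' ^ d" using K by simp
      also have "\<dots> \<le> e' ^ 1" using e' d by (intro power_decreasing) auto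
      finally show "(K * (e' / K)) ^ d \<le> e" using e' by simp
    qed
    finally show ?thesis by simp
  qed
  then have "y \<le> 0" by (rule ennreal_le_epsilon)
  then show ?thesis by simp
qed

theorem mainTheorem5:
  fixes M :: "'a measure"
    and T :: "int ^ 'd \<Rightarrow> 'a \<Rightarrow> 'a"
    and c :: "int ^ 'd \<Rightarrow> 'a \<Rightarrow> ('b::banach \<Rightarrow>\<^sub>L real) \<Rightarrow> ('b \<Rightarrow>\<^sub>L real)"
    and s :: "'a \<Rightarrow> int ^ 'd \<Rightarrow> int ^ 'd \<Rightarrow> ('b \<Rightarrow>\<^sub>L real)"
    and N :: "real ^ 'd \<Rightarrow> real"
  assumes "prob_space M"
    and "ergodic_action M T"
    and "borel_cocycle M T c"
    and "gelfand_cocycle M T c s"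
    and "\<forall>n. (\<lambda>x. s x 0 n) \<in> lorentz_wstar_p1 M (real CARD('d))"
    and "is_norm_on N"
  shows "\<exists>C>0. \<forall>lam::real. lam \<ge> 1 \<longrightarrow>
     emeasure M {x \<in> space M.
        (SUP n\<in>{n. n \<noteq> 0}. ennreal (norm (s x 0 n) / N (int_vec_to_real n))) \<ge> ennreal lam}
     \<le> (ennreal (C / lam) * lorentz_norm_p1 M (real CARD('d))
           (\<lambda>x. MAX k\<in>UNIV. max (norm (s x 0 (axis k 1))) (norm (s x 0 (- axis k 1)))))
        ^ CARD('d)"
proof -
  let ?d = "CARD('d)"
  define f where "f = (\<lambda>x. MAX k\<in>(UNIV::'d set). max (norm (s x 0 (axis k 1))) (norm (s x 0 (- axis k 1))))"
  have T: "mp_action M T" using assms(2) by (simp add: ergodic_action_def)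
  have add: "s x m l + s x l n = s x m n" and equivariant: "c k x (s (T k x) m n) = s x (m + k) (n + k)"
    if "x \<in> space M" for x k l m n
    using assms(4) that by (auto simp: gelfand_cocycle_def)
  have [measurable]: "(\<lambda>x. norm (s x m n)) \<in> borel_measurable M" for m n
    using assms(4) by (simp add: gelfand_cocycle_def)
  have isometric: "norm (c k x z) = norm z" if "x \<in> space M" for k x z
    using assms(3) that by (simp add: borel_cocycle_def)
  have f_meas: "f \<in> borel_measurable M"
    unfolding f_def by (rule borel_measurable_Max) measurable
  have f_ge: "norm (s x 0 (- axis k 1)) \<le> f x" for x k
  proof -
    have "max (norm (s x 0 (axis k 1))) (norm (s x 0 (- axis k 1))) \<le> f x"
      unfolding f_def by (rule Max_ge) (auto intro: rangeI)
    then show ?thesis by simp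
  qed
  have f_nonneg: "0 \<le> f x" for x by (rule order_trans[OF norm_ge_zero f_ge])
  have u0: "s x 0 0 = 0" if "x \<in> space M" for x using add[OF that, of 0 0 0] by simp
  have grad: "norm (s x 0 (m - axis k 1) - s x 0 m) \<le> f (T m x)" if x: "x \<in> space M" for x m k
  proof -
    \<comment> \<open>Additivity makes the increment a value based at m; equivariance moves it to
      the base point 0 over T_m x, and the isometry c(m,x) preserves its norm.\<close>
    have "s x 0 (m - axis k 1) - s x 0 m = s x m (m - axis k 1)"
      using add[OF x, of 0 m "m - axis k 1"] by (metis add_diff_cancel_left')
    also have "\<dots> = c m x (s (T m x) 0 (- axis k 1))"
      using equivariant[OF x, of m 0 "- axis k 1"] by simp
    finally show ?thesis using f_ge[of "T m x" k] by (simp add: isometric x)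
  qed
  obtain c0 where c0: "c0 > 0" "\<And>y. c0 * norm y \<le> N y"
    using is_norm_on_lower_bound[OF assms(6)] by blast
  define L where "L = lorentz_norm_p1 M (real ?d) f"
  \<comment> \<open>The constant depends only on d and on the comparison constant of N; 190 is 10 *
    19, from the maximal inequality and from \<open>\<theta>\<close>.\<close>
  define C where "C = 190 * 100 ^ ?d / c0"
  have C: "C > 0" using c0 by (simp add: C_def)
  let ?\<mu> = "\<lambda>lam::real. emeasure M {x \<in> space M.
        (SUP n\<in>{n. n \<noteq> 0}. ennreal (norm (s x 0 n) / N (int_vec_to_real n))) \<ge> ennreal lam}"
  have weak: "?\<mu> lam \<le> ennreal ((C * S / lam) ^ ?d)" if "S > 0" "L \<le> ennreal S" "lam > 0" for S lam
    unfolding C_def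
    by (rule maximal_function_weak_type[where u = "\<lambda>x. s x 0", OF assms(1) T f_meas f_nonneg u0 grad c0])
       (use that in \<open>simp_all add: L_def\<close>)
  have "?\<mu> lam \<le> (ennreal (C / lam) * L) ^ ?d" if "lam \<ge> 1" for lam
  proof (cases L)
    case (real S)
    show ?thesis
    proof (cases "S = 0")
      case True
      \<comment> \<open>A zero Lorentz norm is bounded by every \<epsilon> > 0, so the weak-type
        bound applies with arbitrarily small \<open>S\<close>.\<close>
      have "?\<mu> lam = 0"
      proof (rule ennreal_le_zero_of_le_power[of "C / lam" ?d])
        fix \<epsilon> :: real assume "\<epsilon> > 0"
        then show "?\<mu> lam \<le> ennreal ((C / lam * \<epsilon>) ^ ?d)"
          using weak[of \<epsilon> lam] that real True by simp
      qed (use C that in \<open>simp_all add: Suc_leI\<close>)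
      then show ?thesis by simp
    next
      case False
      then have "?\<mu> lam \<le> ennreal ((C * S / lam) ^ ?d)" using weak[of S lam] real that by simp
      also have "\<dots> = (ennreal (C / lam) * L) ^ ?d"
        using real C that by (simp add: ennreal_power flip: ennreal_mult)
      finally show ?thesis .
    qed
  next
    case top
    then have "ennreal (C / lam) * L = top" using C that by (simp add: ennreal_mult_top)
    then show ?thesis by (simp add: top_power_ennreal)
  qed
  then show ?thesis unfolding L_def f_def using C by blast
qed

end
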